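(* Assume the hypotheses of the main addition theorem (see context). Let $r\in\{1,\ldots,\ell+1\}$ and suppose $S_{r-1}(\wp(z_1),\ldots,\wp(z_\ell))\neq0$. Then \[ \wp(z_1+\cdots+z_\ell)=\frac{1}{S_{r-1}(\wp(z_1),\ldots,\wp(z_\ell))}\left((-1)^r\frac{\mu(\ell+1-r)}{\mu(\ell+1)}-S_r(\wp(z_1),\ldots,\wp(z_\ell))\right). \]
   Context: Let $\omega_1,\omega_2\in\mathbb{C}$ with $\mathrm{Im}(\omega_2/\omega_1)>0$, $\Lambda=2\omega_1\mathbb{Z}+2\omega_2\mathbb{Z}$, $\wp$ the Weierstrass elliptic function of $\Lambda$ with invariants $g_2,g_3$, so $(\wp')^2=4\wp^3-g_2\wp-g_3$. For $j\ge0$, $\wp^{(j)}$ is the $j$-th derivative ($\wp^{(0)}=\wp$), and $\wp^{(-2)}\equiv1$; the index $-2$ counts as even. $\mathbb{N}=\{0,1,2,\ldots\}$. Standing setup: $m,\ell\ge1$; $n_1,\ldots,n_m$ pairwise distinct in $\mathbb{N}\cup\{-2\}$, $k_1,\ldots,k_\ell$ pairwise distinct in $\mathbb{N}\cup\{-2\}$, with $\ell=\max(\max_i n_i,\max_i k_i)+1$; $\gamma_1,\ldots,\gamma_m\in\mathbb{C}$; $z_1,\ldots,z_\ell\in\mathbb{C}\setminus\Lambda$ with $\det(\wp^{(k_j)}(z_i))_{i,j=1}^\ell\ne0$; $\lambda_1,\ldots,\lambda_\ell$ the unique solution of $\sum_{i=1}^m\gamma_i\wp^{(n_i)}(z_j)=\sum_{i=1}^\ell\lambda_i\wp^{(k_i)}(z_j)$,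 $j=1,\ldots,\ell$; $z=z_1+\cdots+z_\ell\notin\Lambda$; and $\psi(s)=\sum_i\gamma_i\wp^{(n_i)}(s)-\sum_i\lambda_i\wp^{(k_i)}(s)$ has a pole of order exactly $\ell+1$ at $0$. Define $\varphi(s)=\big(\sum_{n_i\text{ odd}}\gamma_i\wp^{(n_i)}(s)-\sum_{k_i\text{ odd}}\lambda_i\wp^{(k_i)}(s)\big)^2-\big(\sum_{n_i\text{ even}}\gamma_i\wp^{(n_i)}(s)-\sum_{k_i\text{ even}}\lambda_i\wp^{(k_i)}(s)\big)^2$, a polynomial in $\wp(s)$ of degree at most $\ell+1$ with coefficients $\mu(r)$: $\varphi(s)=\sum_{r=0}^{\ell+1}\mu(r)\wp(s)^r$. Hypotheses of the main addition theorem: $\varphi\not\equiv0$, $z\not\equiv\pm z_i\pmod\Lambda$ for all $i$, $z_i\not\equiv-z_j\pmod\Lambda$ for $i\ne j$. $S_r$ is the $r$-th elementary symmetric polynomial ($S_0=1$, $S_r=0$ when $r$ exceeds the number of variables). *)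

theory Defs
  imports "HOL-Complex_Analysis.Complex_Analysis" "HOL-Computational_Algebra.Polynomial"
    "Jordan_Normal_Form.Determinant"
begin

definition lattice :: "complex \<Rightarrow> complex \<Rightarrow> complex set" where
  "lattice w1 w2 = {of_int a * (2 * w1) + of_int b * (2 * w2) | a b. True}"

text \<open>Weierstrass elliptic function of the lattice (absolutely convergent series,
  written as an unordered infinite sum); meaningful for z not in the lattice.\<close>
definition wp :: "complex \<Rightarrow> complex \<Rightarrow> complex \<Rightarrow> complex" where
  "wp w1 w2 z = 1 / z\<^sup>2 + infsum (\<lambda>w. 1 / (z - w)\<^sup>2 - 1 / w\<^sup>2) (lattice w1 w2 - {0})"

text \<open>wp^{(j)} for j >= 0 and wp^{(-2)} = 1; indices live in int, only -2 and
  nonnegative values are used.\<close>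
definition wpd :: "complex \<Rightarrow> complex \<Rightarrow> int \<Rightarrow> complex \<Rightarrow> complex" where
  "wpd w1 w2 j z = (if j = -2 then 1 else (deriv ^^ nat j) (wp w1 w2) z)"

definition esym :: "nat \<Rightarrow> (nat \<Rightarrow> complex) \<Rightarrow> nat \<Rightarrow> complex" where
  "esym r a l = (\<Sum>I\<in>{I. I \<subseteq> {..<l} \<and> card I = r}. \<Prod>i\<in>I. a i)"

end

(*
  Write psi(s) for the function with a pole of order l + 1 at 0, so that phi(s) = - psi(s) psi(-s).
  With theta the infinite product (1 - x) prod_(n >= 1) (1 - q^n x) (1 - q^n / x), where
  x = exp (pi i s / w1) and q = exp (2 pi i w2 / w1), and z = z_1 + ... + z_l, the function
    h(s) = theta(s - z_1) ... theta(s - z_l) theta(s + z) / theta(s)^(l + 1)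
  is elliptic with poles only in the lattice, of order l + 1.  Hence h lies in the span of 1 and
  the derivatives of the Weierstrass function of order < l.  So does psi, both vanish at all z_i,
  and the determinant condition leaves only a one-dimensional space of such functions; so
  psi = c h.  The pairing theta(s - a) theta(s + a) / theta(s)^2 = c_a (wp(s) - wp(a)) then gives
    phi(s) = C (wp(s) - wp(z_1)) ... (wp(s) - wp(z_l)) (wp(s) - wp(z)),
  and Vieta's formulas finish the proof.  Contour integration is avoided throughout: everything
  about elliptic functions comes from Liouville's theorem.
*)
theory Submission
  imports Defs
begin

section \<open>The period lattice\<close>

text \<open>The classical route counts the zeros of psi by residues and locates the missing one by
  Abel's relation. Here the order is reversed: a function with the right zeros is written down
  first, and linear algebra identifies it with psi. The factor theta(s + z) has a simple origin:
  shifting s by 2 w2 multiplies theta(s - a) / theta(s) by the number exp(pi i a / w1), so a product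
  of such quotients is elliptic once the shifts a sum to 0. The remaining obstacle is that no
  elliptic function has a single simple pole, usually read off from the residue sum. It starts the
  induction behind the span and is obtained here from values at the half periods. The line of
  admissible functions is a matter of counting: the indices -2, 0, ..., l - 1 are l + 1 in number,
  and the k_i leave out exactly one.\<close>

definition lattice_pt :: "complex \<Rightarrow> complex \<Rightarrow> int \<times> int \<Rightarrow> complex" where
  "lattice_pt w1 w2 = (\<lambda>(a, b). of_int a * (2 * w1) + of_int b * (2 * w2))"

lemma lattice_eq_range: "lattice w1 w2 = range (lattice_pt w1 w2)"
  unfolding lattice_def lattice_pt_def by (auto simp: image_def)

text \<open>The exponent 3/2 is half of the 3 in \<open>summable_inverse_cube\<close>: it still
  exceeds 1, and one such factor per coordinate dominates the inverse cube on the lattice.\<close>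

lemma summable_int_powr: "(\<lambda>a::int. (1 + \<bar>real_of_int a\<bar>) powr (- 3 / 2)) summable_on UNIV"
proof -
  have "summable (\<lambda>n. real (Suc n) powr (- 3 / 2))"
    by (subst summable_Suc_iff) (simp add: summable_real_powr_iff)
  then have nat: "(\<lambda>n::nat. (1 + real n) powr (- 3 / 2)) summable_on UNIV"
    by (intro summable_nonneg_imp_summable_on) (auto simp: add_ac)
  have pos: "(\<lambda>a::int. (1 + \<bar>real_of_int a\<bar>) powr (- 3 / 2)) summable_on range int"
    by (subst summable_on_reindex) (use nat in \<open>auto simp: o_def\<close>)
  have neg: "(\<lambda>a::int. (1 + \<bar>real_of_int a\<bar>) powr (- 3 / 2)) summable_on range (\<lambda>n. - int n)"
    by (subst summable_on_reindex) (use nat in \<open>auto simp: o_def inj_on_def\<close>)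
  have "(UNIV :: int set) = range int \<union> range (\<lambda>n. - int n)"
    by (auto simp: image_iff) (metis int_cases2)
  then show ?thesis
    using summable_on_union[OF pos neg] by simp
qed

lemma summable_int_prod_powr:
  "(\<lambda>x::int\<times>int. (1 + \<bar>real_of_int (fst x)\<bar>) powr (- 3 / 2) * (1 + \<bar>real_of_int (snd x)\<bar>) powr (- 3 / 2))
     summable_on UNIV"
proof -
  have "(\<lambda>x::int\<times>int. (1 + \<bar>real_of_int (fst x)\<bar>) powr (- 3 / 2) * (1 + \<bar>real_of_int (snd x)\<bar>) powr (- 3 / 2))
     summable_on (UNIV \<times> UNIV)"
  proof (rule summable_on_SigmaI)
    show "((\<lambda>y. (1 + \<bar>real_of_int (fst (x, y))\<bar>) powr (- 3 / 2) * (1 + \<bar>real_of_int (snd (x, y))\<bar>) powr (- 3 / 2))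
        has_sum (1 + \<bar>real_of_int x\<bar>) powr (- 3 / 2) * (\<Sum>\<^sub>\<infinity>a. (1 + \<bar>real_of_int a\<bar>) powr (- 3 / 2))) UNIV" for x
      unfolding fst_conv snd_conv by (intro has_sum_cmult_right has_sum_infsum summable_int_powr)
    show "(\<lambda>x. (1 + \<bar>real_of_int x\<bar>) powr (- 3 / 2) * (\<Sum>\<^sub>\<infinity>a. (1 + \<bar>real_of_int a\<bar>) powr (- 3 / 2))) summable_on UNIV"
      by (intro summable_on_cmult_left summable_int_powr)
  qed auto
  then show ?thesis by simp
qed

text \<open>The sign of the imaginary part stays open, so that the locale also applies to the
  swapped pair \<open>w2\<close>, \<open>w1\<close>; the second period is obtained that way.\<close>

locale period_pair =
  fixes w1 w2 :: complex
  assumes Im_ratio: "Im (w2 / w1) \<noteq> 0"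
begin

abbreviation "\<Lambda> \<equiv> lattice w1 w2"
abbreviation "W \<equiv> lattice_pt w1 w2"

lemma w1_nz: "w1 \<noteq> 0"
  using Im_ratio by auto

text \<open>With \<open>u = a + b * t\<close>, the imaginary part of \<open>u\<close> sees only
  \<open>b\<close>, and that of \<open>u * cnj t\<close> only \<open>a\<close>, because
  \<open>t * cnj t\<close> is real.\<close>

lemma lattice_pt_bound:
  obtains c where "c > 0" "\<And>x. c * max \<bar>real_of_int (fst x)\<bar> \<bar>real_of_int (snd x)\<bar> \<le> norm (W x)"
proof
  define t where "t = w2 / w1"
  have t: "Im t \<noteq> 0" using Im_ratio by (simp add: t_def)
  then have nt: "norm t > 0" by auto
  define d where "d = min \<bar>Im t\<bar> (\<bar>Im t\<bar> / norm t)"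
  show "2 * norm w1 * d > 0"
    using t nt w1_nz by (simp add: d_def)
  fix x :: "int \<times> int"
  obtain a b where x: "x = (a, b)" by force
  define u where "u = of_int a + of_int b * t"
  have "W x = 2 * w1 * u"
    using w1_nz by (simp add: x lattice_pt_def t_def u_def field_simps)
  then have W: "norm (W x) = 2 * norm w1 * norm u"
    by (simp add: norm_mult)
  have "Im u = of_int b * Im t"
    by (simp add: u_def)
  then have b: "\<bar>real_of_int b\<bar> * \<bar>Im t\<bar> \<le> norm u"
    by (metis abs_Im_le_cmod abs_mult)
  have "Im (u * cnj t) = - of_int a * Im t"
    by (simp add: u_def algebra_simps)
  then have "\<bar>real_of_int a\<bar> * \<bar>Im t\<bar> \<le> norm (u * cnj t)"
    by (metis abs_Im_le_cmod abs_mult abs_minus_cancel)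
  then have "\<bar>real_of_int a\<bar> * \<bar>Im t\<bar> \<le> norm u * norm t"
    by (simp add: norm_mult)
  then have a: "\<bar>real_of_int a\<bar> * (\<bar>Im t\<bar> / norm t) \<le> norm u"
    using nt by (simp add: pos_divide_le_eq)
  have "\<bar>real_of_int a\<bar> * d \<le> norm u"
    using a mult_left_mono[OF min.cobounded2[of "\<bar>Im t\<bar>" "\<bar>Im t\<bar> / norm t"], of "\<bar>real_of_int a\<bar>"]
    unfolding d_def by linarith
  moreover have "\<bar>real_of_int b\<bar> * d \<le> norm u"
    using b mult_left_mono[OF min.cobounded1[of "\<bar>Im t\<bar>" "\<bar>Im t\<bar> / norm t"], of "\<bar>real_of_int b\<bar>"]
    unfolding d_def by linarith
  ultimately have "d * max \<bar>real_of_int a\<bar> \<bar>real_of_int b\<bar> \<le> norm u"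
    by (simp add: max_def mult.commute)
  then have "2 * norm w1 * (d * max \<bar>real_of_int a\<bar> \<bar>real_of_int b\<bar>) \<le> 2 * norm w1 * norm u"
    by (intro mult_left_mono) auto
  then show "2 * norm w1 * d * max \<bar>real_of_int (fst x)\<bar> \<bar>real_of_int (snd x)\<bar> \<le> norm (W x)"
    unfolding W by (simp add: x mult.assoc)
qed

lemma lattice_pt_eq_0_iff: "W x = 0 \<longleftrightarrow> x = (0, 0)"
proof
  assume "W x = 0"
  obtain c where c: "c > 0" "\<And>x. c * max \<bar>real_of_int (fst x)\<bar> \<bar>real_of_int (snd x)\<bar> \<le> norm (W x)"
    using lattice_pt_bound by blast
  have "max \<bar>real_of_int (fst x)\<bar> \<bar>real_of_int (snd x)\<bar> \<le> 0"
    using c(2)[of x] c(1) \<open>W x = 0\<close> by (simp only: norm_zero mult_le_0_iff) auto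
  then show "x = (0, 0)" by (cases x) auto
qed (simp add: lattice_pt_def)

lemma lattice_pt_diff: "W x - W y = W (x - y)" and lattice_pt_add: "W x + W y = W (x + y)"
  and lattice_pt_uminus: "- W x = W (- x)"
  by (cases x; cases y; simp add: lattice_pt_def algebra_simps)+

lemma inj_lattice_pt: "inj W"
proof (rule injI)
  fix x y assume "W x = W y"
  then have "W (x - y) = 0" by (simp flip: lattice_pt_diff)
  then show "x = y" by (simp add: lattice_pt_eq_0_iff prod_eq_iff)
qed

lemma finite_lattice_pt: "finite {x. norm (W x) < R}"
proof -
  obtain c where c: "c > 0" "\<And>x. c * max \<bar>real_of_int (fst x)\<bar> \<bar>real_of_int (snd x)\<bar> \<le> norm (W x)"
    using lattice_pt_bound by blast
  have "{x. norm (W x) < R} \<subseteq> {-\<lceil>R / c\<rceil>..\<lceil>R / c\<rceil>} \<times> {-\<lceil>R / c\<rceil>..\<lceil>R / c\<rceil>}"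
  proof
    fix x assume "x \<in> {x. norm (W x) < R}"
    then have "c * max \<bar>real_of_int (fst x)\<bar> \<bar>real_of_int (snd x)\<bar> < R"
      using c(2)[of x] by simp
    then have "max \<bar>real_of_int (fst x)\<bar> \<bar>real_of_int (snd x)\<bar> < R / c"
      using c(1) by (simp only: pos_less_divide_eq mult.commute)
    then have "\<bar>fst x\<bar> \<le> \<lceil>R / c\<rceil>" "\<bar>snd x\<bar> \<le> \<lceil>R / c\<rceil>"
      by (auto simp: le_ceiling_iff)
    then show "x \<in> {-\<lceil>R / c\<rceil>..\<lceil>R / c\<rceil>} \<times> {-\<lceil>R / c\<rceil>..\<lceil>R / c\<rceil>}"
      by (cases x) auto
  qed
  then show ?thesis
    by (rule finite_subset) auto
qed

text \<open>Distinct lattice points are at least \<open>c\<close> apart. Arbitrary subsets are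
  allowed because both \<open>\<Lambda>\<close> and \<open>\<Lambda> - {0}\<close> are removed from
  the plane later.\<close>

lemma closed_lattice_subset: assumes "A \<subseteq> \<Lambda>" shows "closed A"
proof -
  obtain c where c: "c > 0" "\<And>x. c * max \<bar>real_of_int (fst x)\<bar> \<bar>real_of_int (snd x)\<bar> \<le> norm (W x)"
    using lattice_pt_bound by blast
  have "W x = W y" if "dist (W y) (W x) < c" for x y
  proof (rule ccontr)
    assume "W x \<noteq> W y"
    then have "y - x \<noteq> (0,0)" by (auto simp: zero_prod_def[symmetric])
    then have "1 \<le> max \<bar>real_of_int (fst (y-x))\<bar> \<bar>real_of_int (snd (y-x))\<bar>"
      by (cases "y - x") auto
    then have "c \<le> c * max \<bar>real_of_int (fst (y-x))\<bar> \<bar>real_of_int (snd (y-x))\<bar>"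
      using c(1) by simp
    also have "\<dots> \<le> norm (W (y - x))" by (rule c(2))
    also have "\<dots> = dist (W y) (W x)" by (simp add: dist_norm lattice_pt_diff)
    finally show False using that by simp
  qed
  then have "\<forall>x\<in>\<Lambda>. \<forall>y\<in>\<Lambda>. dist y x < c \<longrightarrow> y = x"
    unfolding lattice_eq_range by force
  then have "\<forall>x\<in>A. \<forall>y\<in>A. dist y x < c \<longrightarrow> y = x"
    using assms by blast
  then show ?thesis
    by (rule discrete_imp_closed[OF c(1)])
qed

lemma summable_inverse_cube:
  "(\<lambda>x. 1 / norm (W x) ^ 3) summable_on UNIV"
proof -
  obtain c where c: "c > 0" "\<And>x. c * max \<bar>real_of_int (fst x)\<bar> \<bar>real_of_int (snd x)\<bar> \<le> norm (W x)"
    using lattice_pt_bound by blast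
  let ?f = "\<lambda>a::int. (1 + \<bar>real_of_int a\<bar>) powr (- 3 / 2)"
  show ?thesis
  proof (rule summable_on_comparison_test)
    \<comment> \<open>Off the origin \<open>1 + |a|\<close> is at most \<open>2 * M\<close>, with
      \<open>M\<close> the larger absolute coordinate; 8 is the cube of that 2. At the origin the
      left side is 0, as division by zero gives 0.\<close>
    show "(\<lambda>x. 8 / c ^ 3 * (?f (fst x) * ?f (snd x))) summable_on UNIV"
      by (intro summable_on_cmult_right summable_int_prod_powr)
    fix x :: "int \<times> int"
    show "1 / norm (W x) ^ 3 \<le> 8 / c ^ 3 * (?f (fst x) * ?f (snd x))"
    proof (cases "x = (0,0)")
      case True
      then show ?thesis using c by (simp add: lattice_pt_def)
    next
      case False
      define M where "M = max \<bar>real_of_int (fst x)\<bar> \<bar>real_of_int (snd x)\<bar>"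
      have M: "1 \<le> M" using False unfolding M_def by (cases x) auto
      have "(2 * M) powr (- 3 / 2) \<le> ?f (fst x)" "(2 * M) powr (- 3 / 2) \<le> ?f (snd x)"
        by (rule powr_mono2'; use M in \<open>auto simp: M_def\<close>)+
      then have "(2 * M) powr (- 3 / 2) * (2 * M) powr (- 3 / 2) \<le> ?f (fst x) * ?f (snd x)"
        by (intro mult_mono) auto
      moreover have "(2 * M) powr (- 3 / 2) * (2 * M) powr (- 3 / 2) = 1 / (2 * M) ^ 3"
        using M by (simp add: powr_minus_divide powr_numeral flip: powr_add)
      ultimately have *: "1 / (8 * M ^ 3) \<le> ?f (fst x) * ?f (snd x)"
        by (simp add: power_mult_distrib)
      have "(c * M) ^ 3 \<le> norm (W x) ^ 3"
        using c M by (intro power_mono) (auto simp: M_def)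
      then have "1 / norm (W x) ^ 3 \<le> 1 / (c * M) ^ 3"
        using c M by (intro divide_left_mono mult_pos_pos) (auto simp: False lattice_pt_eq_0_iff)
      also have "\<dots> = 8 / c ^ 3 * (1 / (8 * M ^ 3))"
        by (simp add: power_mult_distrib)
      also have "\<dots> \<le> 8 / c ^ 3 * (?f (fst x) * ?f (snd x))"
        using c * by (intro mult_left_mono) auto
      finally show ?thesis .
    qed
  qed auto
qed

end

section \<open>The Weierstrass function\<close>

text \<open>Over a common denominator the numerator is \<open>s * (2 * w - s)\<close>, only linear
  in \<open>w\<close>, so one power is gained. The 10 is 5/2, from |2w - s| <= 5/2 |w|, times 4,
  from |s - w| >= |w| / 2.\<close>

lemma weierstrass_term_bound:
  fixes s w :: complex
  assumes "R > 0" "norm s \<le> R" "2 * R \<le> norm w"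
  shows "norm (1 / (s - w)\<^sup>2 - 1 / w\<^sup>2) \<le> 10 * R * (1 / norm w ^ 3)"
proof -
  have w: "norm w > 0" using assms by linarith
  have sw: "norm w / 2 \<le> norm (s - w)"
    using norm_triangle_ineq2[of w s] assms by (simp add: norm_minus_commute)
  then have nz: "w \<noteq> 0" "s - w \<noteq> 0" using w by auto
  have "1 / (s - w)\<^sup>2 - 1 / w\<^sup>2 = s * (2 * w - s) / ((s - w)\<^sup>2 * w\<^sup>2)"
    using nz by (simp add: divide_simps) (simp add: power2_eq_square algebra_simps)
  then have "norm (1 / (s - w)\<^sup>2 - 1 / w\<^sup>2) = norm s * norm (2 * w - s) / ((norm (s - w))\<^sup>2 * (norm w)\<^sup>2)"
    by (simp add: norm_mult norm_divide norm_power)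
  also have "\<dots> \<le> R * (5 / 2 * norm w) / ((norm w / 2)\<^sup>2 * (norm w)\<^sup>2)"
  proof (intro frac_le mult_mono power_mono mult_nonneg_nonneg)
    have "norm (2 * w - s) \<le> norm (2 * w) + norm s" by (rule norm_triangle_ineq4)
    then show "norm (2 * w - s) \<le> 5 / 2 * norm w"
      using assms by (simp add: norm_mult)
  qed (use assms w sw in auto)
  also have "\<dots> = 10 * R * (1 / norm w ^ 3)"
    using w by (simp add: field_simps power2_eq_square power3_eq_cube)
  finally show ?thesis .
qed

lemma
  fixes f g :: "'a \<Rightarrow> complex"
  assumes "f summable_on A" "g summable_on A"
  shows summable_on_diff_fun: "(\<lambda>x. f x - g x) summable_on A"
    and infsum_diff_fun: "infsum (\<lambda>x. f x - g x) A = infsum f A - infsum g A"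
  using summable_on_add[of f A "\<lambda>x. - g x"] infsum_add[of f A "\<lambda>x. - g x"] assms
  by (simp_all add: summable_on_uminus infsum_uminus)

context period_pair
begin

text \<open>Since division by zero gives zero, the term at the origin is \<open>1 / s\<^sup>2\<close>, so that \<open>wp\<close>
  is the sum of these terms over the whole lattice.\<close>

definition wterm :: "complex \<Rightarrow> int \<times> int \<Rightarrow> complex" where
  "wterm s x = 1 / (s - W x)\<^sup>2 - 1 / (W x)\<^sup>2"

definition wp_reg :: "complex \<Rightarrow> complex" where
  "wp_reg s = infsum (wterm s) (- {(0, 0)})"

lemma zero_in_lattice: "0 \<in> \<Lambda>"
  unfolding lattice_eq_range using lattice_pt_eq_0_iff by (metis rangeI)

lemma lattice_add: "x \<in> \<Lambda> \<Longrightarrow> y \<in> \<Lambda> \<Longrightarrow> x + y \<in> \<Lambda>"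
  unfolding lattice_eq_range by (auto simp: lattice_pt_add)

lemma lattice_uminus_iff: "- x \<in> \<Lambda> \<longleftrightarrow> x \<in> \<Lambda>"
  unfolding lattice_eq_range by (metis (no_types, lifting) image_iff lattice_pt_uminus minus_minus rangeI)

lemma lattice_add_iff: "y \<in> \<Lambda> \<Longrightarrow> x + y \<in> \<Lambda> \<longleftrightarrow> x \<in> \<Lambda>"
  using lattice_add[of "x + y" "- y"] lattice_add[of x y] by (auto simp: lattice_uminus_iff)

lemma period1_in_lattice: "2 * w1 \<in> \<Lambda>" and period2_in_lattice: "2 * w2 \<in> \<Lambda>"
  unfolding lattice_eq_range
  by (rule range_eqI[of _ _ "(1, 0)"], simp add: lattice_pt_def)
     (rule range_eqI[of _ _ "(0, 1)"], simp add: lattice_pt_def)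

lemma uniform_limit_wterm:
  assumes "R > 0"
  shows "uniform_limit (cball 0 R) (\<lambda>X s. \<Sum>x\<in>X. wterm s x)
     (\<lambda>s. infsum (wterm s) {x. 2 * R \<le> norm (W x)}) (finite_subsets_at_top {x. 2 * R \<le> norm (W x)})"
proof (rule Weierstrass_m_test_general)
  show "norm (wterm s x) \<le> 10 * R * (1 / norm (W x) ^ 3)"
    if "x \<in> {x. 2 * R \<le> norm (W x)}" "s \<in> cball 0 R" for s x
    unfolding wterm_def using weierstrass_term_bound[of R s "W x"] assms that by simp
  show "(\<lambda>x. 10 * R * (1 / norm (W x) ^ 3)) summable_on {x. 2 * R \<le> norm (W x)}"
    by (intro summable_on_cmult_right summable_on_subset_banach[OF summable_inverse_cube]) auto
qed

lemma summable_wterm_far: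
  assumes "R > 0" "norm s \<le> R"
  shows "wterm s summable_on {x. 2 * R \<le> norm (W x)}"
proof (rule abs_summable_summable, rule Infinite_Sum.abs_summable_on_comparison_test')
  show "(\<lambda>x. 10 * R * (1 / norm (W x) ^ 3)) summable_on {x. 2 * R \<le> norm (W x)}"
    by (intro summable_on_cmult_right summable_on_subset_banach[OF summable_inverse_cube]) auto
  show "norm (wterm s x) \<le> 10 * R * (1 / norm (W x) ^ 3)" if "x \<in> {x. 2 * R \<le> norm (W x)}" for x
    unfolding wterm_def using weierstrass_term_bound[of R s "W x"] assms that by simp
qed

text \<open>Lattice points \<open>s\<close> are included: only finitely many terms escape the bound,
  and division by zero still gives each of them a value. Hence evenness and periodicity of
  \<open>wp\<close> can be stated for every \<open>s\<close>.\<close>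

lemma summable_wterm: "wterm s summable_on A"
proof -
  define R where "R = norm s + 1"
  have R: "R > 0" "norm s \<le> R" by (auto simp: R_def add_nonneg_pos)
  have "wterm s summable_on {x. norm (W x) < 2 * R} \<union> {x. 2 * R \<le> norm (W x)}"
    by (intro summable_on_union summable_wterm_far R summable_on_finite finite_lattice_pt)
  moreover have "{x. norm (W x) < 2 * R} \<union> {x. 2 * R \<le> norm (W x)} = UNIV" by auto
  ultimately show ?thesis
    using summable_on_subset_banach[of "wterm s" UNIV A] by simp
qed

lemma wp_eq_reg: "wp w1 w2 s = 1 / s\<^sup>2 + wp_reg s"
proof -
  have "\<Lambda> - {0} = W ` (- {(0, 0)})"
    unfolding lattice_eq_range by (auto simp: lattice_pt_eq_0_iff image_iff)
  moreover have "inj_on W (- {(0, 0)})"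
    using inj_lattice_pt by (rule inj_on_subset) auto
  ultimately show ?thesis
    unfolding wp_def wp_reg_def by (simp add: infsum_reindex o_def wterm_def[abs_def])
qed

lemma wp_eq_infsum: "wp w1 w2 s = infsum (wterm s) UNIV"
proof -
  have "infsum (wterm s) (insert (0, 0) (- {(0, 0)})) = wterm s (0, 0) + infsum (wterm s) (- {(0, 0)})"
    by (intro infsum_insert summable_wterm) auto
  moreover have "insert (0, 0) (- {(0, 0)}) = (UNIV :: (int \<times> int) set)" by auto
  moreover have "wterm s (0, 0) = 1 / s\<^sup>2" by (simp add: wterm_def lattice_pt_def)
  ultimately show ?thesis
    by (simp add: wp_eq_reg wp_reg_def)
qed

lemma open_compl_lattice: "open (- \<Lambda>)" "open (- (\<Lambda> - {0}))"
  by (intro open_Compl closed_lattice_subset; auto)+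

text \<open>Near \<open>p\<close> the finitely many lattice points of norm below
  \<open>2 * R\<close> are split off; the remaining sum is a uniform limit on the disc of radius
  \<open>R\<close>, where its terms have no poles.\<close>

lemma holomorphic_wp_reg: "wp_reg holomorphic_on - (\<Lambda> - {0})"
proof -
  have "wp_reg field_differentiable (at p)" if p: "p \<in> - (\<Lambda> - {0})" for p
  proof -
    define R where "R = norm p + 1"
    have R: "R > 0" by (auto simp: R_def add_nonneg_pos)
    let ?B = "{x. norm (W x) < 2 * R} - {(0, 0)}" and ?C = "{x. 2 * R \<le> norm (W x)}"
    have fin: "finite ?B" using finite_lattice_pt by auto
    have split: "wp_reg s = (\<Sum>x\<in>?B. wterm s x) + infsum (wterm s) ?C" for s
    proof -
      have "- {(0, 0)} = ?B \<union> ?C" using R by (auto simp: lattice_pt_eq_0_iff lattice_pt_def)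
      then have "wp_reg s = infsum (wterm s) (?B \<union> ?C)" by (simp only: wp_reg_def)
      also have "\<dots> = infsum (wterm s) ?B + infsum (wterm s) ?C"
        by (intro infsum_Un_disjoint summable_wterm) auto
      finally show ?thesis using fin by simp
    qed
    let ?S = "ball 0 R \<inter> - (\<Lambda> - {0})"
    have fin_hol: "(\<lambda>s. \<Sum>x\<in>X. wterm s x) holomorphic_on S" if "\<And>x. x \<in> X \<Longrightarrow> W x \<notin> S" for X S
      unfolding wterm_def using that by (intro holomorphic_intros) auto
    have "(\<lambda>s. infsum (wterm s) ?C) holomorphic_on ball 0 R"
    proof (rule holomorphic_uniform_limit[OF _ uniform_limit_wterm[OF R]])
      have "eventually (\<lambda>X. finite X \<and> X \<subseteq> ?C) (finite_subsets_at_top ?C)"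
        by (simp add: eventually_finite_subsets_at_top_weakI)
      then show "\<forall>\<^sub>F X in finite_subsets_at_top ?C. continuous_on (cball 0 R) (\<lambda>s. \<Sum>x\<in>X. wterm s x) \<and>
          (\<lambda>s. \<Sum>x\<in>X. wterm s x) holomorphic_on ball 0 R"
      proof eventually_elim
        case (elim X)
        then have "W x \<notin> cball 0 R" if "x \<in> X" for x
          using that R by auto
        then have "(\<lambda>s. \<Sum>x\<in>X. wterm s x) holomorphic_on cball 0 R"
          by (rule fin_hol)
        then show ?case
          by (auto intro: holomorphic_on_imp_continuous_on holomorphic_on_subset)
      qed
    qed auto
    moreover have "(\<lambda>s. \<Sum>x\<in>?B. wterm s x) holomorphic_on ?S"
      by (rule fin_hol) (auto simp: lattice_eq_range lattice_pt_eq_0_iff)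
    ultimately have "wp_reg holomorphic_on ?S"
      unfolding split by (intro holomorphic_on_add) (auto intro: holomorphic_on_subset)
    moreover have "open ?S" "p \<in> ?S"
      by (intro open_Int open_ball open_compl_lattice) (rule IntI, simp add: R_def, fact)
    ultimately show ?thesis
      using holomorphic_on_imp_differentiable_at by blast
  qed
  then show ?thesis
    by (auto simp: holomorphic_on_def intro: field_differentiable_at_within)
qed

lemma holomorphic_wp: "wp w1 w2 holomorphic_on - \<Lambda>"
proof -
  have "(\<lambda>s. 1 / s\<^sup>2 + wp_reg s) holomorphic_on - \<Lambda>"
    using zero_in_lattice by (intro holomorphic_intros holomorphic_on_subset[OF holomorphic_wp_reg]) auto
  then show ?thesis by (simp add: wp_eq_reg[abs_def])
qed

section \<open>Symmetry and periods of the Weierstrass function\<close>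

lemma wp_even: "wp w1 w2 (- s) = wp w1 w2 s"
proof -
  have "infsum (wterm (- s)) UNIV = infsum (wterm s \<circ> uminus) UNIV"
    by (rule infsum_cong) (simp add: wterm_def power2_eq_square algebra_simps flip: lattice_pt_uminus)
  also have "\<dots> = infsum (wterm s) (range uminus)"
    by (rule infsum_reindex[symmetric]) auto
  finally show ?thesis by (simp add: wp_eq_infsum)
qed

text \<open>Over the whole lattice these terms are not summable without their correction, but along
  a row they decay like \<open>1 / a\<^sup>2\<close>. This permits splitting the row differences
  before they telescope.\<close>

lemma summable_row: "(\<lambda>a. 1 / (s - W (a, b))\<^sup>2) summable_on UNIV"
proof -
  have inj: "inj (\<lambda>a::int. (a, b))" by (auto intro: injI)
  have "wterm s summable_on range (\<lambda>a. (a, b))" by (rule summable_wterm)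
  then have 1: "(\<lambda>a. wterm s (a, b)) summable_on UNIV"
    by (subst (asm) summable_on_reindex[OF inj]) (simp add: o_def)
  obtain c where c: "c > 0" "\<And>x. c * max \<bar>real_of_int (fst x)\<bar> \<bar>real_of_int (snd x)\<bar> \<le> norm (W x)"
    using lattice_pt_bound by blast
  have "(\<lambda>a. 1 / (W (a, b))\<^sup>2) summable_on UNIV"
  proof (rule abs_summable_summable, rule Infinite_Sum.abs_summable_on_comparison_test')
    show "(\<lambda>a. 4 / c\<^sup>2 * (1 + \<bar>real_of_int a\<bar>) powr (- 3 / 2)) summable_on UNIV"
      by (intro summable_on_cmult_right summable_int_powr)
    fix a :: int
    show "norm (1 / (W (a, b))\<^sup>2) \<le> 4 / c\<^sup>2 * (1 + \<bar>real_of_int a\<bar>) powr (- 3 / 2)"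
    proof (cases "(a, b) = (0, 0)")
      case True
      then show ?thesis by (simp add: lattice_pt_def)
    next
      case False
      \<comment> \<open>Off the origin some coordinate is at least 1 in absolute value, so the
        larger one is at least this \<open>M\<close>; squaring the 1/2 yields the 4.\<close>
      define M where "M = (1 + \<bar>real_of_int a\<bar>) / 2"
      have M: "M > 0" by (simp add: M_def add_pos_nonneg)
      have "M \<le> max \<bar>real_of_int a\<bar> \<bar>real_of_int b\<bar>"
        unfolding M_def using False by (cases "a = 0"; cases "b = 0") (auto simp: le_max_iff_disj)
      then have "c * M \<le> c * max \<bar>real_of_int a\<bar> \<bar>real_of_int b\<bar>"
        using c(1) by simp
      then have "c * M \<le> norm (W (a, b))"
        using c(2)[of "(a, b)"] by simp
      then have "1 / (norm (W (a, b)))\<^sup>2 \<le> 1 / (c * M)\<^sup>2"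
        using c(1) M False by (intro divide_left_mono power_mono mult_pos_pos) (auto simp: lattice_pt_eq_0_iff)
      also have "\<dots> = 4 / c\<^sup>2 * (1 + \<bar>real_of_int a\<bar>) powr (- 2)"
        by (simp add: M_def power_mult_distrib power_divide powr_minus_divide powr_numeral)
      also have "\<dots> \<le> 4 / c\<^sup>2 * (1 + \<bar>real_of_int a\<bar>) powr (- 3 / 2)"
        by (intro mult_left_mono powr_mono) auto
      finally show ?thesis by (simp add: norm_divide norm_power)
    qed
  qed
  from summable_on_add[OF 1 this] show ?thesis
    by (simp add: wterm_def)
qed

text \<open>Summing the difference of the two series along rows parallel to \<open>w1\<close>, each row telescopes.\<close>

lemma wp_period1: "wp w1 w2 (s + 2 * w1) = wp w1 w2 s"
proof -
  let ?d = "\<lambda>x. wterm (s + 2 * w1) x - wterm s x"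
  have eq: "?d (a, b) = 1 / (s - W (a - 1, b))\<^sup>2 - 1 / (s - W (a, b))\<^sup>2" for a b
    by (simp add: wterm_def lattice_pt_def algebra_simps)
  have row: "infsum (\<lambda>a. ?d (a, b)) UNIV = 0" for b
  proof -
    let ?v = "\<lambda>a. 1 / (s - W (a, b))\<^sup>2"
    have bij: "bij (\<lambda>a::int. a - 1)"
      by (rule bij_betw_byWitness[where f' = "\<lambda>a. a + 1"]) auto
    have "infsum (\<lambda>a. ?v (a - 1)) UNIV = infsum ?v UNIV"
      by (rule infsum_reindex_bij_betw[OF bij])
    moreover have "(\<lambda>a. ?v (a - 1)) summable_on UNIV"
      using summable_on_reindex_bij_betw[OF bij, of ?v] summable_row by blast
    ultimately show ?thesis
      unfolding eq using infsum_diff_fun[OF _ summable_row] by simp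
  qed
  have sm: "?d summable_on UNIV"
    by (intro summable_on_diff_fun summable_wterm)
  have "wp w1 w2 (s + 2 * w1) - wp w1 w2 s = infsum ?d UNIV"
    unfolding wp_eq_infsum by (intro infsum_diff_fun[symmetric] summable_wterm)
  \<comment> \<open>The inner sum of an iterated sum runs over the second component, while a row
    runs over the first; hence the swap.\<close>
  also have "\<dots> = infsum (?d \<circ> prod.swap) UNIV"
    by (subst infsum_reindex[symmetric]) (auto simp: surj_swap)
  also have "\<dots> = infsum (\<lambda>b. infsum (\<lambda>a. (?d \<circ> prod.swap) (b, a)) UNIV) UNIV"
  proof -
    have "(?d \<circ> prod.swap) summable_on UNIV"
      using sm by (subst summable_on_reindex[symmetric]) (auto simp: surj_swap)
    then show ?thesis
      using infsum_Sigma_banach[of "?d \<circ> prod.swap" UNIV "\<lambda>_. UNIV"] by simp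
  qed
  also have "\<dots> = 0" using row by simp
  finally show ?thesis by simp
qed

end

lemma lattice_commute: "lattice w1 w2 = lattice w2 w1"
  unfolding lattice_def by (auto simp: add.commute) (metis add.commute)+

lemma wp_commute: "wp w1 w2 s = wp w2 w1 s"
  unfolding wp_def by (simp add: lattice_commute)

text \<open>The defining series is an unordered sum over a set symmetric in the two periods, so this
  is the first period of the swapped pair.\<close>

lemma (in period_pair) wp_period2: "wp w1 w2 (s + 2 * w2) = wp w1 w2 s"
proof -
  have "Im (w1 / w2) \<noteq> 0"
    using Im_ratio Im_complex_div_eq_0 Im_complex_div_gt_0 
    by (metis complex_is_Real_iff inverse_divide Reals_inverse)
  then interpret swap: period_pair w2 w1 by unfold_locales
  show ?thesis
    using swap.wp_period1 by (simp add: wp_commute[of w1 w2])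
qed

section \<open>Elliptic functions with poles in the lattice\<close>

context period_pair
begin

text \<open>Values on the lattice are left arbitrary, and nothing is asked about the singularity at
  0: its order is controlled separately, through limits of \<open>s ^ N * f s\<close>.\<close>

definition elliptic :: "(complex \<Rightarrow> complex) \<Rightarrow> bool" where
  "elliptic f \<longleftrightarrow> f holomorphic_on - \<Lambda> \<and> (\<forall>s. s \<notin> \<Lambda> \<longrightarrow> f (s + 2 * w1) = f s \<and> f (s + 2 * w2) = f s)"

lemma elliptic_holomorphic: "elliptic f \<Longrightarrow> f holomorphic_on - \<Lambda>"
  by (simp add: elliptic_def)

lemma lattice_shift_iff [simp]: "s + 2 * w1 \<in> \<Lambda> \<longleftrightarrow> s \<in> \<Lambda>" "s + 2 * w2 \<in> \<Lambda> \<longleftrightarrow> s \<in> \<Lambda>"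
  by (simp_all add: lattice_add_iff period1_in_lattice period2_in_lattice)

lemma periodic_int_multiple:
  fixes f :: "complex \<Rightarrow> complex"
  assumes "\<And>s. s \<notin> \<Lambda> \<Longrightarrow> f (s + p) = f s" "p \<in> \<Lambda>" "s \<notin> \<Lambda>"
  shows "s + of_int a * p \<notin> \<Lambda> \<and> f (s + of_int a * p) = f s"
proof -
  have nat: "s + of_nat n * p \<notin> \<Lambda> \<and> f (s + of_nat n * p) = f s" if "s \<notin> \<Lambda>" for n s
  proof (induction n)
    case (Suc n)
    have eq: "s + of_nat (Suc n) * p = (s + of_nat n * p) + p" by (simp add: algebra_simps)
    show ?case unfolding eq using Suc assms lattice_add_iff by auto
  qed (use that in simp)
  have mem: "of_nat n * p \<in> \<Lambda>" for n
    by (induction n) (use assms(2) zero_in_lattice in \<open>auto simp: algebra_simps intro: lattice_add\<close>)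
  show ?thesis
  proof (cases a rule: int_cases2)
    case (nonneg n)
    then show ?thesis using nat assms(3) by simp
  next
    case (nonpos n)
    have "s - of_nat n * p \<notin> \<Lambda>"
      using lattice_add_iff[OF mem, of "s - of_nat n * p" n] assms(3) by simp
    then show ?thesis using nat[of "s - of_nat n * p" n] nonpos by simp
  qed
qed

lemma elliptic_periodic:
  assumes "elliptic f" "w \<in> \<Lambda>" "s \<notin> \<Lambda>"
  shows "f (s + w) = f s"
proof -
  obtain a b where w: "w = of_int a * (2 * w1) + of_int b * (2 * w2)"
    using assms(2) unfolding lattice_def by blast
  have 1: "s + of_int a * (2 * w1) \<notin> \<Lambda> \<and> f (s + of_int a * (2 * w1)) = f s"
    by (rule periodic_int_multiple) (use assms in \<open>auto simp: elliptic_def period1_in_lattice\<close>)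
  have "f (s + of_int a * (2 * w1) + of_int b * (2 * w2)) = f (s + of_int a * (2 * w1))"
    using periodic_int_multiple[of f "2 * w2" "s + of_int a * (2 * w1)" b] 1 assms
    by (auto simp: elliptic_def period2_in_lattice)
  then show ?thesis using 1 w by (simp add: add.assoc)
qed

lemma elliptic_const: "elliptic (\<lambda>_. c)"
  by (simp add: elliptic_def)

lemma elliptic_diff: "elliptic f \<Longrightarrow> elliptic g \<Longrightarrow> elliptic (\<lambda>s. f s - g s)"
  by (auto simp: elliptic_def intro!: holomorphic_intros)

lemma elliptic_mult: "elliptic f \<Longrightarrow> elliptic g \<Longrightarrow> elliptic (\<lambda>s. f s * g s)"
  by (auto simp: elliptic_def intro!: holomorphic_intros)

lemma elliptic_reflect:
  assumes f: "elliptic f" shows "elliptic (\<lambda>s. f (- s))"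
proof -
  have "(f \<circ> uminus) holomorphic_on - \<Lambda>"
    by (rule holomorphic_on_compose_gen[OF _ elliptic_holomorphic[OF f]])
       (auto intro!: holomorphic_intros simp: lattice_uminus_iff)
  moreover have "f (- (s + w)) = f (- s)" if "s \<notin> \<Lambda>" "w \<in> \<Lambda>" for s w
    using elliptic_periodic[OF f, of "- w" "- s"] that by (simp add: lattice_uminus_iff)
  ultimately show ?thesis
    by (auto simp: elliptic_def o_def period1_in_lattice period2_in_lattice)
qed

lemma elliptic_deriv:
  assumes f: "elliptic f" shows "elliptic (deriv f)"
proof -
  have "deriv f (s + p) = deriv f s" if s: "s \<notin> \<Lambda>" and p: "\<And>s. s \<notin> \<Lambda> \<Longrightarrow> f (s + p) = f s" "s + p \<notin> \<Lambda>" for s p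
  proof -
    have "(f has_field_derivative deriv f (s + p)) (at (s + p))"
      using holomorphic_derivI[OF elliptic_holomorphic[OF f] open_compl_lattice(1)] p by simp
    then have "((\<lambda>s. f (s + p)) has_field_derivative deriv f (s + p)) (at s)"
      by (simp add: DERIV_shift)
    then have "(f has_field_derivative deriv f (s + p)) (at s)"
      by (rule has_field_derivative_transform_within_open[OF _ open_compl_lattice(1)]) (use s p in auto)
    then show ?thesis by (simp add: DERIV_imp_deriv)
  qed
  moreover have "deriv f holomorphic_on - \<Lambda>"
    by (intro holomorphic_deriv elliptic_holomorphic f open_compl_lattice)
  ultimately show ?thesis
    using f by (simp add: elliptic_def)
qed

lemma elliptic_wp: "elliptic (wp w1 w2)"
  by (simp add: elliptic_def holomorphic_wp wp_period1 wp_period2)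

lemma elliptic_higher_deriv_wp: "elliptic ((deriv ^^ j) (wp w1 w2))"
  by (induction j) (simp_all add: elliptic_wp elliptic_deriv)

text \<open>Lowers a pole order by one: \<open>s * f s\<close>, extended by 0, is holomorphic and
  vanishes at 0, so its difference quotient \<open>f\<close> tends to its derivative.\<close>

lemma tendsto_div_at_0:
  assumes "f holomorphic_on - \<Lambda>" "((\<lambda>s. s * f s) \<longlongrightarrow> 0) (at 0)"
  shows "\<exists>c. (f \<longlongrightarrow> c) (at 0)"
proof -
  define g where "g = (\<lambda>s. if s = 0 then 0 else s * f s)"
  have "g holomorphic_on - (\<Lambda> - {0})"
    unfolding g_def
  proof (rule removable_singularity)
    show "(\<lambda>s. s * f s) holomorphic_on - (\<Lambda> - {0}) - {0}"
      by (rule holomorphic_on_subset[of _ "- \<Lambda>"]) (use assms(1) in \<open>auto intro!: holomorphic_intros\<close>)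
  qed (use assms open_compl_lattice in auto)
  then have "(g has_field_derivative deriv g 0) (at 0)"
    by (rule holomorphic_derivI[OF _ open_compl_lattice(2)]) auto
  moreover have "g 0 = 0" by (simp add: g_def)
  ultimately have "((\<lambda>h. g h / h) \<longlongrightarrow> deriv g 0) (at 0)"
    by (simp add: DERIV_def)
  then have "(f \<longlongrightarrow> deriv g 0) (at 0)"
    by (rule Lim_transform_eventually) (auto simp: eventually_at_filter g_def)
  then show ?thesis by blast
qed

section \<open>Liouville's theorem for elliptic functions\<close>

lemma lattice_reduce:
  obtains w x y where "w \<in> \<Lambda>" "0 \<le> x" "x \<le> 1" "0 \<le> y" "y \<le> 1"
    "s = of_real x * (2 * w1) + of_real y * (2 * w2) + w"
proof -
  define t where "t = w2 / w1"
  define u where "u = s / (2 * w1)"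
  have t: "Im t \<noteq> 0" using Im_ratio by (simp add: t_def)
  define y where "y = Im u / Im t"
  define x where "x = Re u - y * Re t"
  have "u = of_real x + of_real y * t"
    using t by (simp add: complex_eq_iff x_def y_def)
  then have s: "s = of_real x * (2 * w1) + of_real y * (2 * w2)"
    using w1_nz by (simp add: u_def t_def field_simps)
  show ?thesis
  proof
    show "of_int \<lfloor>x\<rfloor> * (2 * w1) + of_int \<lfloor>y\<rfloor> * (2 * w2) \<in> \<Lambda>"
      unfolding lattice_def by blast
    have frac: "complex_of_real v = of_real (frac v) + of_int \<lfloor>v\<rfloor>" for v
      by (simp add: frac_def)
    show "s = of_real (frac x) * (2 * w1) + of_real (frac y) * (2 * w2) + (of_int \<lfloor>x\<rfloor> * (2 * w1) + of_int \<lfloor>y\<rfloor> * (2 * w2))"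
      unfolding s by (subst frac[of x], subst frac[of y]) (simp only: distrib_right add_ac)
  qed (auto simp: frac_ge_0 less_imp_le[OF frac_lt_1])
qed

lemma elliptic_Liouville:
  assumes f: "elliptic f" and lim: "((\<lambda>s. s * f s) \<longlongrightarrow> 0) (at 0)"
  shows "\<exists>c. \<forall>s. s \<notin> \<Lambda> \<longrightarrow> f s = c"
proof -
  obtain c where c: "(f \<longlongrightarrow> c) (at 0)"
    using tendsto_div_at_0[OF elliptic_holomorphic[OF f] lim] by blast
  let ?A = "- (\<Lambda> - {0})"
  \<comment> \<open>By periodicity the limit at 0 is the right value at every lattice point, and
    differentiability there is carried over from 0.\<close>
  define g where "g = (\<lambda>s. if s \<in> \<Lambda> then c else f s)"
  have per: "g (s + w) = g s" if "w \<in> \<Lambda>" for s w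
    using that elliptic_periodic[OF f that] by (auto simp: g_def lattice_add_iff)
  have "(\<lambda>s. if s = 0 then c else f s) holomorphic_on ?A"
  proof (rule removable_singularity)
    show "f holomorphic_on ?A - {0}"
      by (rule holomorphic_on_subset[OF elliptic_holomorphic[OF f]]) auto
  qed (use c open_compl_lattice in auto)
  then have "g holomorphic_on ?A"
    by (rule holomorphic_transform) (use zero_in_lattice in \<open>auto simp: g_def\<close>)
  then have diff: "g field_differentiable (at s)" if "s \<in> ?A" for s
    using that open_compl_lattice(2) holomorphic_on_imp_differentiable_at by blast
  have "g field_differentiable (at s)" for s
  proof (cases "s \<in> \<Lambda>")
    case True
    obtain D where "(g has_field_derivative D) (at 0)"
      using diff[of 0] by (auto simp: field_differentiable_def)
    then have "((\<lambda>u. g (u + - s)) has_field_derivative D) (at s)"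
      using DERIV_shift[of g D s "- s"] by simp
    moreover have "(\<lambda>u. g (u + - s)) = g"
      using per[of "- s"] True by (auto simp: lattice_uminus_iff)
    ultimately show ?thesis by (auto simp: field_differentiable_def)
  qed (rule diff, simp)
  then have hol: "g holomorphic_on UNIV"
    by (auto simp: holomorphic_on_def)
  define K where "K = (\<lambda>(x, y). of_real x * (2 * w1) + of_real y * (2 * w2)) ` ({0..1::real} \<times> {0..1::real})"
  have "compact K"
    unfolding K_def case_prod_unfold
    by (intro compact_continuous_image compact_Times continuous_intros) auto
  then have "bounded (g ` K)"
    by (intro compact_imp_bounded compact_continuous_image holomorphic_on_imp_continuous_on
          holomorphic_on_subset[OF hol]) auto
  moreover have "range g \<subseteq> g ` K"
  proof
    fix v assume "v \<in> range g"
    then obtain s where v: "v = g s" by blast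
    obtain w x y where "w \<in> \<Lambda>" "0 \<le> x" "x \<le> 1" "0 \<le> y" "y \<le> 1"
      and s: "s = of_real x * (2 * w1) + of_real y * (2 * w2) + w"
      by (rule lattice_reduce)
    moreover from this have "v = g (of_real x * (2 * w1) + of_real y * (2 * w2))"
      unfolding v s by (simp add: per)
    ultimately show "v \<in> g ` K" unfolding K_def by force
  qed
  ultimately have "g constant_on UNIV"
    using Liouville_theorem[OF hol] bounded_subset by blast
  then show ?thesis unfolding constant_on_def g_def by (metis UNIV_I)
qed

section \<open>Principal parts at the origin\<close>

lemma eventually_at_0_not_lattice: "\<forall>\<^sub>F s in at 0. s \<notin> \<Lambda>"
proof -
  have "\<forall>\<^sub>F s in at 0. s \<in> - (\<Lambda> - {0})"
    by (rule eventually_at_in_open'[OF open_compl_lattice(2)]) simp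
  then show ?thesis by (auto simp: eventually_at_filter elim: eventually_mono)
qed

text \<open>The first summand is the \<open>j\<close>-th derivative of \<open>1 / s\<^sup>2\<close>;
  it is the whole singular part at 0, as \<open>wp_reg\<close> is holomorphic there.\<close>

lemma higher_deriv_wp_eq:
  assumes "s \<notin> \<Lambda>"
  shows "(deriv ^^ j) (wp w1 w2) s = (-1) ^ j * fact (j + 1) / s ^ (j + 2) + (deriv ^^ j) wp_reg s"
  using assms
proof (induction j arbitrary: s)
  case 0
  then show ?case by (simp add: wp_eq_reg power2_eq_square)
next
  case (Suc j)
  have s0: "s \<noteq> 0" using Suc.prems zero_in_lattice by auto
  have "(deriv ^^ j) wp_reg holomorphic_on - (\<Lambda> - {0})"
    by (intro holomorphic_higher_deriv holomorphic_wp_reg open_compl_lattice)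
  then have 1: "((deriv ^^ j) wp_reg has_field_derivative (deriv ^^ Suc j) wp_reg s) (at s)"
    using holomorphic_derivI[OF _ open_compl_lattice(2), of "(deriv ^^ j) wp_reg" s] Suc.prems by simp
  have "((\<lambda>s. (-1) ^ j * fact (j + 1) / s ^ (j + 2)) has_field_derivative
      (-1) ^ Suc j * fact (Suc j + 1) / s ^ (Suc j + 2)) (at s)"
  proof -
    have 2: "((\<lambda>s. s ^ (j + 2)) has_field_derivative of_nat (j + 2) * s ^ (j + 1)) (at s)"
      using DERIV_power[OF DERIV_ident, of "j + 2" s] by simp
    have f: "(fact (Suc j + 1) :: complex) = of_nat (j + 2) * fact (j + 1)" by (simp add: algebra_simps)
    define p where "p = s ^ (j + 1)"
    have p: "s ^ (j + 1) = p" "s ^ (j + 2) = p * s" "s ^ (Suc j + 2) = p * s * s" "p \<noteq> 0"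
      using s0 by (auto simp: p_def)
    show ?thesis
    proof (rule DERIV_cong[OF DERIV_divide[OF DERIV_const 2]])
      show "(0 * s ^ (j + 2) - (-1) ^ j * fact (j + 1) * (of_nat (j + 2) * s ^ (j + 1))) / (s ^ (j + 2) * s ^ (j + 2))
          = (-1) ^ Suc j * fact (Suc j + 1) / s ^ (Suc j + 2)"
        unfolding f p(1-3) using s0 p(4) by (simp add: divide_simps)
    qed (use s0 in simp)
  qed
  from DERIV_add[OF this 1]
  have "((deriv ^^ j) (wp w1 w2) has_field_derivative
      ((-1) ^ Suc j * fact (Suc j + 1) / s ^ (Suc j + 2) + (deriv ^^ Suc j) wp_reg s)) (at s)"
    by (rule has_field_derivative_transform_within_open[OF _ open_compl_lattice(1)]) (use Suc in auto)
  then show ?case by (simp add: DERIV_imp_deriv)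
qed

lemma tendsto_higher_deriv_wp:
  "((\<lambda>s. s ^ (j + 2) * (deriv ^^ j) (wp w1 w2) s) \<longlongrightarrow> (-1) ^ j * fact (j + 1)) (at 0)"
proof -
  have "isCont ((deriv ^^ j) wp_reg) 0"
    using holomorphic_on_imp_continuous_on[OF holomorphic_higher_deriv[OF holomorphic_wp_reg open_compl_lattice(2), of j]]
    unfolding continuous_on_eq_continuous_at[OF open_compl_lattice(2)] by blast
  then have "((\<lambda>s. (-1) ^ j * fact (j + 1) + s ^ (j + 2) * (deriv ^^ j) wp_reg s) \<longlongrightarrow>
      (-1) ^ j * fact (j + 1) + 0 ^ (j + 2) * (deriv ^^ j) wp_reg 0) (at 0)"
    by (intro tendsto_intros) (simp add: isCont_def)
  then have "((\<lambda>s. (-1) ^ j * fact (j + 1) + s ^ (j + 2) * (deriv ^^ j) wp_reg s) \<longlongrightarrow>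
      (-1) ^ j * fact (j + 1)) (at 0)" by simp
  then show ?thesis
  proof (rule Lim_transform_eventually)
    show "\<forall>\<^sub>F s in at 0. (-1) ^ j * fact (j + 1) + s ^ (j + 2) * (deriv ^^ j) wp_reg s
        = s ^ (j + 2) * (deriv ^^ j) (wp w1 w2) s"
      using eventually_at_0_not_lattice
    proof eventually_elim
      case (elim s)
      then have "s \<noteq> 0" using zero_in_lattice by auto
      then show ?case by (simp only: higher_deriv_wp_eq[OF elim] distrib_left) simp
    qed
  qed
qed

text \<open>Subtracting \<open>c * wp w1 w2 s\<close> leaves at most a simple pole at 0, with
  residue \<open>r\<close>. Evenness makes \<open>s * F s\<close> odd, so \<open>r = - r\<close>,
  and Liouville applies.\<close>

lemma elliptic_even_double_pole:
  assumes f: "elliptic f" and even: "\<And>s. s \<notin> \<Lambda> \<Longrightarrow> f (- s) = f s"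
    and lim: "((\<lambda>s. s\<^sup>2 * f s) \<longlongrightarrow> c) (at 0)"
  shows "\<exists>d. \<forall>s. s \<notin> \<Lambda> \<longrightarrow> f s = c * wp w1 w2 s + d"
proof -
  define F where "F = (\<lambda>s. f s - c * wp w1 w2 s)"
  have F: "elliptic F"
    unfolding F_def by (intro elliptic_diff elliptic_mult elliptic_const elliptic_wp f)
  have "((\<lambda>s. s\<^sup>2 * f s - c * (s ^ (0 + 2) * (deriv ^^ 0) (wp w1 w2) s)) \<longlongrightarrow> c - c * ((-1) ^ 0 * fact (0 + 1))) (at 0)"
    by (intro tendsto_intros lim tendsto_higher_deriv_wp)
  then have "((\<lambda>s. s * (s * F s)) \<longlongrightarrow> 0) (at 0)"
    by (simp add: F_def algebra_simps power2_eq_square)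
  moreover have "(\<lambda>s. s * F s) holomorphic_on - \<Lambda>"
    by (intro holomorphic_intros elliptic_holomorphic F)
  ultimately obtain r where r: "((\<lambda>s. s * F s) \<longlongrightarrow> r) (at 0)"
    using tendsto_div_at_0 by blast
  have "((\<lambda>s. - s * F (- s)) \<longlongrightarrow> r) (at 0)"
    using filterlim_compose[OF r, of uminus "at 0"]
    by (simp add: filterlim_at tendsto_minus_cancel_left[symmetric] eventually_at_filter)
  then have "((\<lambda>s. - (s * F s)) \<longlongrightarrow> r) (at 0)"
    by (rule Lim_transform_eventually)
       (use eventually_at_0_not_lattice in \<open>auto simp: F_def even wp_even elim: eventually_mono\<close>)
  then have "((\<lambda>s. s * F s) \<longlongrightarrow> - r) (at 0)"
    using tendsto_minus by fastforce
  then have "r = - r" using r tendsto_unique by (metis at_neq_bot)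
  then have "r = 0" by simp
  with r elliptic_Liouville[OF F] obtain d where "\<forall>s. s \<notin> \<Lambda> \<longrightarrow> F s = d" by blast
  then show ?thesis by (auto simp: F_def algebra_simps intro!: exI[of _ d])
qed

end

section \<open>A theta product\<close>

text \<open>The q-Pochhammer symbol of infinite length, with base \<open>q\<close> and argument
  \<open>w\<close>.\<close>

definition eprod :: "complex \<Rightarrow> complex \<Rightarrow> complex" where
  "eprod q w = (\<Prod>n. 1 - q ^ n * w)"

lemma convergent_prod_eprod:
  fixes q w :: complex
  assumes "norm q < 1" shows "convergent_prod (\<lambda>n. 1 - q ^ n * w)"
proof -
  have "summable (\<lambda>n. norm q ^ n * norm w)"
    using assms by (intro summable_mult2 summable_geometric) simp
  then have "abs_convergent_prod (\<lambda>n. 1 - q ^ n * w)"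
    by (simp add: abs_convergent_prod_conv_summable norm_mult norm_power)
  then show ?thesis by (rule abs_convergent_prod_imp_convergent_prod)
qed

lemma eprod_eq_0_iff:
  assumes "norm q < 1" shows "eprod q w = 0 \<longleftrightarrow> (\<exists>n. q ^ n * w = 1)"
  using has_prod_eq_0_iff[OF convergent_prod_has_prod[OF convergent_prod_eprod[OF assms]], of w]
  by (auto simp: eprod_def image_iff)

lemma eprod_shift:
  assumes "norm q < 1" shows "eprod q w = (1 - w) * eprod q (q * w)"
\<comment> \<open>Splitting off the first factor divides by \<open>1 - w\<close>, so the zero at
  \<open>w = 1\<close> is treated apart.\<close>
proof (cases "w = 1")
  case True
  then have "eprod q w = 0" by (subst eprod_eq_0_iff[OF assms]) (auto intro: exI[of _ 0])
  then show ?thesis using True by simp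
next
  case False
  have "(\<Prod>n. 1 - q ^ Suc n * w) = eprod q w / (1 - q ^ 0 * w)"
    unfolding eprod_def by (rule prodinf_split_head[OF convergent_prod_eprod[OF assms]]) (use False in simp)
  then show ?thesis using False by (simp add: eprod_def mult_ac)
qed

lemma holomorphic_eprod:
  assumes q: "norm q < 1" shows "eprod q holomorphic_on UNIV"
proof (rule holomorphic_uniform_sequence)
  show "(\<lambda>w. \<Prod>k<n. 1 - q ^ k * w) holomorphic_on UNIV" for n
    by (intro holomorphic_intros)
  fix w :: complex
  have "uniform_limit (cball w 1) (\<lambda>n w. \<Prod>k<n. 1 - q ^ k * w) (eprod q) sequentially"
  proof -
    have "uniformly_convergent_on (cball w 1) (\<lambda>N x. \<Prod>n<N. 1 - q ^ n * x)"
    proof (rule uniformly_convergent_on_prod')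
      show "uniformly_convergent_on (cball w 1) (\<lambda>N x. \<Sum>n<N. norm (1 - q ^ n * x - 1))"
      proof (rule Weierstrass_m_test')
        show "norm (norm (1 - q ^ n * x - 1)) \<le> norm q ^ n * (norm w + 1)" if "x \<in> cball w 1" for n x
        proof -
          have "norm x \<le> norm w + 1"
            using that norm_triangle_ineq2[of x w] by (simp add: dist_norm norm_minus_commute)
          then show ?thesis by (simp add: norm_mult norm_power mult_left_mono)
        qed
        show "summable (\<lambda>n. norm q ^ n * (norm w + 1))"
          using q by (intro summable_mult2 summable_geometric) simp
      qed
    qed (auto intro!: continuous_intros)
    then obtain L where L: "uniform_limit (cball w 1) (\<lambda>N x. \<Prod>n<N. 1 - q ^ n * x) L sequentially"
      by (auto simp: uniformly_convergent_on_def)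
    have "L x = eprod q x" if "x \<in> cball w 1" for x
    proof -
      have "(\<lambda>N. \<Prod>n<N. 1 - q ^ n * x) \<longlonglongrightarrow> L x"
        by (rule tendsto_uniform_limitI[OF L that])
      moreover have "(\<lambda>N. \<Prod>n<N. 1 - q ^ n * x) \<longlonglongrightarrow> eprod q x"
        using convergent_prod_LIMSEQ[OF convergent_prod_eprod[OF q, of x]]
        by (simp add: eprod_def LIMSEQ_lessThan_iff_atMost)
      ultimately show ?thesis by (rule LIMSEQ_unique)
    qed
    then show ?thesis
      using uniform_limit_cong'[of "cball w 1" "\<lambda>N x. \<Prod>n<N. 1 - q ^ n * x" "\<lambda>N x. \<Prod>n<N. 1 - q ^ n * x" L "eprod q" sequentially] L
      by simp
  qed
  then show "\<exists>d>0. cball w d \<subseteq> UNIV \<and> uniform_limit (cball w d) (\<lambda>n w. \<Prod>k<n. 1 - q ^ k * w) (eprod q) sequentially"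
    by (intro exI[of _ 1]) auto
qed auto

text \<open>From here the sign matters: it gives \<open>norm nome < 1\<close>, and with it the
  convergence of the theta product.\<close>

locale upper_period_pair =
  fixes w1 w2 :: complex
  assumes Im_ratio_pos: "Im (w2 / w1) > 0"
begin

sublocale period_pair
  by unfold_locales (use Im_ratio_pos in simp)

text \<open>With tau = \<open>w2 / w1\<close>, the classical nome is exp(pi i tau); this is its
  square.\<close>

definition nome :: complex where
  "nome = exp (2 * of_real pi * \<i> * (w2 / w1))"

definition wexp :: "complex \<Rightarrow> complex" where
  "wexp s = exp (of_real pi * \<i> * s / w1)"

text \<open>Up to a constant this is Jacobi's theta_1 at pi s / (2 w1), times exp(pi i s / (2 w1)).
  The exponential turns antiperiodicity under \<open>2 * w1\<close> into periodicity, at the price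
  of the factor in \<open>theta_uminus\<close>.\<close>

definition theta :: "complex \<Rightarrow> complex" where
  "theta s = eprod nome (wexp s) * eprod nome (nome / wexp s)"

text \<open>The derivative of \<open>theta\<close> at the origin.\<close>

definition theta_slope :: complex where
  "theta_slope = - (of_real pi * \<i> / w1) * (eprod nome nome)\<^sup>2"

lemma norm_nome: "norm nome < 1"
proof -
  have "Re (2 * of_real pi * \<i> * t) = - (2 * pi * Im t)" for t by simp
  then show ?thesis
    using Im_ratio_pos by (simp only: nome_def norm_exp_eq_Re) simp
qed

lemma nome_nz: "nome \<noteq> 0"
  by (simp add: nome_def)

lemma wexp_nz [simp]: "wexp s \<noteq> 0" and wexp_0 [simp]: "wexp 0 = 1"
  by (simp_all add: wexp_def)

lemma wexp_add: "wexp (s + t) = wexp s * wexp t"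
  by (simp add: wexp_def exp_add[symmetric] add_divide_distrib distrib_left)

lemma wexp_uminus: "wexp (- s) = 1 / wexp s"
  using wexp_add[of s "- s"] by (simp add: field_simps)

lemma wexp_diff: "wexp (s - t) = wexp s / wexp t"
  using wexp_add[of s "- t"] by (simp add: wexp_uminus)

lemma wexp_sum: "wexp (\<Sum>i\<in>A. f i) = (\<Prod>i\<in>A. wexp (f i))"
  by (induction A rule: infinite_finite_induct) (auto simp: wexp_add)

lemma wexp_period1: "wexp (2 * w1) = 1"
proof -
  have "of_real pi * \<i> * (2 * w1) / w1 = 2 * of_real pi * \<i>" using w1_nz by simp
  then show ?thesis unfolding wexp_def by simp
qed

lemma wexp_period2: "wexp (2 * w2) = nome"
  by (simp add: wexp_def nome_def mult_ac)

lemma theta_period1: "theta (s + 2 * w1) = theta s"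
  by (simp add: theta_def wexp_add wexp_period1)

lemma theta_uminus: "theta (- s) = - theta s / wexp s"
proof -
  have "theta (- s) = eprod nome (1 / wexp s) * eprod nome (nome * wexp s)"
    by (simp add: theta_def wexp_uminus)
  also have "eprod nome (1 / wexp s) = (1 - 1 / wexp s) * eprod nome (nome / wexp s)"
    using eprod_shift[OF norm_nome, of "1 / wexp s"] by simp
  finally show ?thesis
    unfolding theta_def eprod_shift[OF norm_nome, of "wexp s"] by (simp add: field_simps)
qed

text \<open>Multiplying \<open>wexp s\<close> by \<open>nome\<close> and inverting it lead to the
  same two factors, in opposite order.\<close>

lemma theta_period2: "theta (s + 2 * w2) = - theta s / wexp s"
proof -
  have "theta (s + 2 * w2) = theta (- s)"
    unfolding theta_def wexp_uminus wexp_add wexp_period2 using nome_nz by (simp add: mult_ac)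
  then show ?thesis by (simp add: theta_uminus)
qed

lemma theta_0: "theta 0 = 0"
  using eprod_eq_0_iff[OF norm_nome, of 1] by (auto simp: theta_def intro: exI[of _ 0])

lemma wexp_eq_1_imp: assumes "wexp s = 1" shows "s \<in> \<Lambda>"
proof -
  obtain n :: int where "of_real pi * \<i> * s / w1 = of_int (2 * n) * of_real pi * \<i>"
    using assms unfolding wexp_def exp_eq_1 by (force simp: complex_eq_iff)
  then have "s = of_int n * (2 * w1) + of_int 0 * (2 * w2)"
    using w1_nz by (simp add: field_simps)
  then show ?thesis unfolding lattice_def by blast
qed

lemma wexp_eq_nome_power_imp:
  assumes "wexp s = nome ^ n" shows "s \<in> \<Lambda>"
proof -
  have mem: "of_nat n * (2 * w2) \<in> \<Lambda>"
    unfolding lattice_def mem_Collect_eq by (intro exI[of _ 0] exI[of _ "int n"]) simp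
  have "wexp (of_nat n * (2 * w2)) = nome ^ n"
    using wexp_sum[of "\<lambda>_. 2 * w2" "{..<n}"] by (simp add: wexp_period2)
  then have "wexp (s - of_nat n * (2 * w2)) = 1"
    using assms nome_nz by (simp only: wexp_diff) simp
  from lattice_add[OF wexp_eq_1_imp[OF this] mem] show ?thesis by simp
qed

lemma theta_eq_0_imp: assumes "theta s = 0" shows "s \<in> \<Lambda>"
proof -
  have "(\<exists>n. nome ^ n * wexp s = 1) \<or> (\<exists>n. nome ^ n * (nome / wexp s) = 1)"
    using assms by (simp add: theta_def eprod_eq_0_iff norm_nome)
  then obtain n where "nome ^ n * wexp s = 1 \<or> nome ^ n * (nome / wexp s) = 1" by blast
  then show ?thesis
  proof
    assume "nome ^ n * wexp s = 1"
    then have "wexp (- s) = nome ^ n" by (simp add: wexp_uminus field_simps)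
    then show ?thesis using wexp_eq_nome_power_imp lattice_uminus_iff by blast
  next
    assume "nome ^ n * (nome / wexp s) = 1"
    then have "wexp s = nome ^ Suc n" by (simp add: field_simps)
    then show ?thesis by (rule wexp_eq_nome_power_imp)
  qed
qed

lemma holomorphic_theta: "theta holomorphic_on UNIV"
proof -
  have "(eprod nome \<circ> wexp) holomorphic_on UNIV" "(eprod nome \<circ> (\<lambda>s. nome / wexp s)) holomorphic_on UNIV"
    by (rule holomorphic_on_compose_gen[OF _ holomorphic_eprod[OF norm_nome]];
        auto simp: wexp_def[abs_def] intro!: holomorphic_intros simp: w1_nz)+
  then show ?thesis
    unfolding theta_def[abs_def] by (auto simp: o_def intro!: holomorphic_intros)
qed

lemma theta_slope_nz: "theta_slope \<noteq> 0"
proof -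
  have "nome ^ n * nome \<noteq> 1" for n
  proof
    assume "nome ^ n * nome = 1"
    then have "norm nome ^ Suc n = 1" by (metis norm_one norm_power power_Suc2)
    then show False using norm_nome power_less_one_iff[of "norm nome" "Suc n"] by simp
  qed
  then have "eprod nome nome \<noteq> 0" by (simp add: eprod_eq_0_iff norm_nome)
  then show ?thesis by (simp add: theta_slope_def w1_nz)
qed

text \<open>Only the factor \<open>1 - wexp s\<close>, split off by \<open>eprod_shift\<close>,
  vanishes at 0; the remaining product is continuous there, with value
  \<open>(eprod nome nome)\<^sup>2\<close>.\<close>

lemma theta_tendsto: "((\<lambda>s. theta s / s) \<longlongrightarrow> theta_slope) (at 0)"
proof -
  have "(wexp has_field_derivative of_real pi * \<i> / w1) (at 0)"
    unfolding wexp_def[abs_def] by (auto intro!: derivative_eq_intros simp: w1_nz)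
  then have wexp': "((\<lambda>s. (wexp s - 1) / s) \<longlongrightarrow> of_real pi * \<i> / w1) (at 0)"
    by (simp add: DERIV_def)
  have E: "isCont (eprod nome) w" for w
    using holomorphic_on_imp_continuous_on[OF holomorphic_eprod[OF norm_nome]]
    by (simp add: continuous_on_eq_continuous_at)
  have "isCont wexp 0" unfolding wexp_def[abs_def] by (intro continuous_intros) (simp add: w1_nz)
  then have ex0: "(wexp \<longlongrightarrow> 1) (at 0)" by (simp add: isCont_def)
  have "((\<lambda>s. eprod nome (nome * wexp s)) \<longlongrightarrow> eprod nome (nome * 1)) (at 0)"
    "((\<lambda>s. eprod nome (nome / wexp s)) \<longlongrightarrow> eprod nome (nome / 1)) (at 0)"
    by (intro isCont_tendsto_compose[OF E] tendsto_intros ex0; simp)+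
  then have "((\<lambda>s. - ((wexp s - 1) / s) * (eprod nome (nome * wexp s) * eprod nome (nome / wexp s))) \<longlongrightarrow>
      - (of_real pi * \<i> / w1) * (eprod nome (nome * 1) * eprod nome (nome / 1))) (at 0)"
    by (intro tendsto_intros wexp')
  moreover have "- ((wexp s - 1) / s) * (eprod nome (nome * wexp s) * eprod nome (nome / wexp s)) = theta s / s" for s
    unfolding theta_def eprod_shift[OF norm_nome, of "wexp s"] by (simp add: divide_simps) (simp add: algebra_simps)
  ultimately show ?thesis
    by (simp add: theta_slope_def power2_eq_square)
qed

end

section \<open>Theta quotients and the span theorem\<close>

context upper_period_pair
begin

definition theta_quot :: "complex \<Rightarrow> complex \<Rightarrow> complex" where
  "theta_quot a s = theta (s - a) / theta s"

lemma theta_nz: "s \<notin> \<Lambda> \<Longrightarrow> theta s \<noteq> 0"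
  using theta_eq_0_imp by blast

lemma holomorphic_theta_quot: "theta_quot a holomorphic_on - \<Lambda>"
proof -
  have "(theta \<circ> (\<lambda>s. s - a)) holomorphic_on - \<Lambda>"
    by (rule holomorphic_on_compose_gen[OF _ holomorphic_theta]) (auto intro!: holomorphic_intros)
  then show ?thesis
    unfolding theta_quot_def[abs_def] o_def
    by (intro holomorphic_intros holomorphic_on_subset[OF holomorphic_theta]) (auto simp: theta_nz)
qed

lemma theta_quot_period1: "theta_quot a (s + 2 * w1) = theta_quot a s"
  using theta_period1[of "s - a"] theta_period1[of s] by (simp add: theta_quot_def algebra_simps)

text \<open>The automorphy factors of numerator and denominator cancel up to \<open>wexp a\<close>,
  so the multiplier does not depend on \<open>s\<close>.\<close>

lemma theta_quot_period2: "theta_quot a (s + 2 * w2) = wexp a * theta_quot a s"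
  using theta_period2[of "s - a"] theta_period2[of s]
  by (simp add: theta_quot_def add_diff_eq[symmetric] diff_add_eq wexp_diff)

lemma theta_quot_uminus: "theta_quot a (- s) = theta_quot (- a) s / wexp a"
  using theta_uminus[of "s + a"] theta_uminus[of s]
  by (simp add: theta_quot_def wexp_add)

lemma theta_quot_self: "theta_quot a a = 0"
  by (simp add: theta_quot_def theta_0)

lemma theta_quot_nz: "s \<notin> \<Lambda> \<Longrightarrow> s - a \<notin> \<Lambda> \<Longrightarrow> theta_quot a s \<noteq> 0"
  by (simp add: theta_quot_def theta_nz)

lemma theta_quot_tendsto: "((\<lambda>s. s * theta_quot a s) \<longlongrightarrow> theta (- a) / theta_slope) (at 0)"
proof -
  have "isCont theta (0 - a)"
    using holomorphic_on_imp_continuous_on[OF holomorphic_theta] by (simp add: continuous_on_eq_continuous_at)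
  then have "((\<lambda>s. theta (s - a)) \<longlongrightarrow> theta (0 - a)) (at 0)"
    by (rule isCont_tendsto_compose) (intro tendsto_intros)
  then have "((\<lambda>s. theta (s - a) / (theta s / s)) \<longlongrightarrow> theta (0 - a) / theta_slope) (at 0)"
    by (intro tendsto_divide theta_tendsto theta_slope_nz)
  then show ?thesis
    by (simp add: theta_quot_def mult.commute)
qed

lemma elliptic_prod_theta_quot:
  assumes "(\<Sum>i<N. a i) = 0"
  shows "elliptic (\<lambda>s. \<Prod>i<N. theta_quot (a i) s)"
proof -
  have "(\<Prod>i<N. wexp (a i)) = 1"
    using assms by (simp flip: wexp_sum)
  then show ?thesis
    unfolding elliptic_def
    by (auto intro!: holomorphic_on_prod holomorphic_theta_quot
        simp: theta_quot_period1 theta_quot_period2 prod.distrib)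
qed

lemma prod_theta_quot_tendsto:
  "((\<lambda>s. s ^ N * (\<Prod>i<N. theta_quot (a i) s)) \<longlongrightarrow> (\<Prod>i<N. theta (- a i) / theta_slope)) (at 0)"
proof -
  have "((\<lambda>s. \<Prod>i<N. s * theta_quot (a i) s) \<longlongrightarrow> (\<Prod>i<N. theta (- a i) / theta_slope)) (at 0)"
    by (intro tendsto_prod theta_quot_tendsto)
  then show ?thesis by (simp add: prod.distrib)
qed

text \<open>The product is even, since the factors from the two reflections cancel, and has a double
  pole, so it is affine in \<open>wp\<close>. Its zero at \<open>a\<close> fixes the constant
  term.\<close>

lemma theta_quot_pair:
  assumes a: "a \<notin> \<Lambda>"
  shows "\<exists>c. c \<noteq> 0 \<and> (\<forall>s. s \<notin> \<Lambda> \<longrightarrow> theta_quot a s * theta_quot (- a) s = c * (wp w1 w2 s - wp w1 w2 a))"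
proof -
  define b where "b = (\<lambda>i::nat. if i = 0 then a else - a)"
  define f where "f = (\<lambda>s. theta_quot a s * theta_quot (- a) s)"
  define c where "c = theta (- a) * theta a / theta_slope\<^sup>2"
  have f: "f = (\<lambda>s. \<Prod>i<2. theta_quot (b i) s)"
    by (simp add: f_def b_def numeral_2_eq_2)
  have "elliptic f"
    unfolding f by (rule elliptic_prod_theta_quot) (simp add: b_def numeral_2_eq_2)
  moreover have "f (- s) = f s" for s
    using theta_quot_uminus[of a s] theta_quot_uminus[of "- a" s]
    by (simp add: f_def wexp_uminus)
  moreover have "((\<lambda>s. s\<^sup>2 * f s) \<longlongrightarrow> c) (at 0)"
    using prod_theta_quot_tendsto[of 2 b]
    unfolding f c_def by (simp add: b_def numeral_2_eq_2 power2_eq_square)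
  ultimately obtain d where d: "\<And>s. s \<notin> \<Lambda> \<Longrightarrow> f s = c * wp w1 w2 s + d"
    using elliptic_even_double_pole by blast
  have "f a = 0" by (simp add: f_def theta_quot_self)
  then have "f s = c * (wp w1 w2 s - wp w1 w2 a)" if "s \<notin> \<Lambda>" for s
    using d[OF a] d[OF that] by (simp add: algebra_simps)
  moreover have "c \<noteq> 0"
    using a theta_nz[of a] theta_nz[of "- a"] by (simp add: c_def theta_slope_nz lattice_uminus_iff)
  ultimately show ?thesis unfolding f_def by blast
qed

section \<open>Half periods and the span of the derivatives\<close>

lemma half_periods:
  "w1 \<notin> \<Lambda>" "w2 \<notin> \<Lambda>" "w2 + w1 \<notin> \<Lambda>" "w2 - w1 \<notin> \<Lambda>"
proof -
  have *: "v \<notin> \<Lambda>" if v: "2 * v = W (x, y)" "odd x \<or> odd y" for v x y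
  proof
    assume "v \<in> \<Lambda>"
    then obtain a b where "v = W (a, b)" unfolding lattice_eq_range by force
    then have "2 * v = W (2 * a, 2 * b)" by (simp add: lattice_pt_def algebra_simps)
    then have "(x, y) = (2 * a, 2 * b)" using v inj_lattice_pt by (metis injD)
    then show False using v by auto
  qed
  show "w1 \<notin> \<Lambda>" by (rule *[of _ 1 0]) (auto simp: lattice_pt_def)
  show "w2 \<notin> \<Lambda>" by (rule *[of _ 0 1]) (auto simp: lattice_pt_def)
  show "w2 + w1 \<notin> \<Lambda>" by (rule *[of _ 1 1]) (auto simp: lattice_pt_def)
  show "w2 - w1 \<notin> \<Lambda>" by (rule *[of _ "-1" 1]) (auto simp: lattice_pt_def)
qed

text \<open>By the pairing formula, equality would make a theta quotient vanish at
  \<open>w2\<close>, although \<open>theta\<close> has no zero at \<open>w2 - w1\<close> or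
  \<open>w2 + w1\<close>.\<close>

lemma wp_half_periods_neq: "wp w1 w2 w1 \<noteq> wp w1 w2 w2"
proof
  assume "wp w1 w2 w1 = wp w1 w2 w2"
  then have "theta_quot w1 w2 * theta_quot (- w1) w2 = 0"
    using theta_quot_pair[OF half_periods(1)] half_periods(2) by auto
  then show False using half_periods theta_quot_nz[of w2 w1] theta_quot_nz[of w2 "- w1"] by auto
qed

text \<open>An odd elliptic function with at most a simple pole has square of the form
  \<open>c \<wp> + d\<close> and vanishes at the half periods, where \<open>\<wp>\<close> takes distinct values;
  so \<open>c = 0\<close>.\<close>

lemma elliptic_simple_pole_const:
  assumes f: "elliptic f" and lim: "((\<lambda>s. s * f s) \<longlongrightarrow> r) (at 0)"
  shows "\<exists>c. \<forall>s. s \<notin> \<Lambda> \<longrightarrow> f s = c"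
proof -
  define g where "g = (\<lambda>s. (f s - f (- s)) / 2)"
  have "elliptic (\<lambda>s. 1 / 2 * (f s - f (- s)))"
    by (intro elliptic_mult elliptic_const elliptic_diff elliptic_reflect f)
  then have g: "elliptic g" by (simp add: g_def)
  have odd: "g (- s) = - g s" for s by (simp add: g_def minus_divide_left)
  \<comment> \<open>The odd part keeps the limit \<open>r\<close>, since \<open>s * f s\<close> and
    \<open>- s * f (- s)\<close> both tend to it.\<close>
  have sg: "(s * f s + - s * f (- s)) / 2 = s * g s" for s by (simp add: g_def right_diff_distrib)
  have "((\<lambda>s. - s * f (- s)) \<longlongrightarrow> r) (at 0)"
    using filterlim_compose[OF lim, of uminus "at 0"]
    by (simp add: filterlim_at tendsto_minus_cancel_left[symmetric] eventually_at_filter)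
  from tendsto_add[OF lim this]
  have "((\<lambda>s. (s * f s + - s * f (- s)) / 2) \<longlongrightarrow> (r + r) / 2) (at 0)"
    by (intro tendsto_divide tendsto_const) auto
  then have glim: "((\<lambda>s. s * g s) \<longlongrightarrow> r) (at 0)"
    unfolding sg by simp
  have "((\<lambda>s. (s * g s) * (s * g s)) \<longlongrightarrow> r * r) (at 0)"
    by (intro tendsto_mult glim)
  then have "((\<lambda>s. s\<^sup>2 * (g s * g s)) \<longlongrightarrow> r * r) (at 0)"
    by (simp add: power2_eq_square mult_ac)
  then obtain d where d: "\<And>s. s \<notin> \<Lambda> \<Longrightarrow> g s * g s = r * r * wp w1 w2 s + d"
    using elliptic_even_double_pole[of "\<lambda>s. g s * g s" "r * r"] elliptic_mult[OF g g] by (auto simp: odd)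
  \<comment> \<open>\<open>w\<close> and \<open>- w\<close> differ by a period, so
    \<open>g w = g (- w) = - g w\<close>.\<close>
  have "g w = 0" if "2 * w \<in> \<Lambda>" "w \<notin> \<Lambda>" for w
    using elliptic_periodic[OF g that(1), of "- w"] that odd[of w] by (simp add: lattice_uminus_iff)
  then have "g w1 = 0" "g w2 = 0"
    using half_periods period1_in_lattice period2_in_lattice by auto
  then have "r * r * wp w1 w2 w1 + d = 0" "r * r * wp w1 w2 w2 + d = 0"
    using d[of w1] d[of w2] half_periods by auto
  moreover have "r * r * (wp w1 w2 w1 - wp w1 w2 w2) = (r * r * wp w1 w2 w1 + d) - (r * r * wp w1 w2 w2 + d)"
    by (simp add: algebra_simps)
  ultimately have "r * r * (wp w1 w2 w1 - wp w1 w2 w2) = 0"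
    by (simp only: diff_self)
  then have "r = 0" using wp_half_periods_neq by simp
  then show ?thesis using elliptic_Liouville[OF f] lim by simp
qed

text \<open>Each step subtracts the multiple of the highest derivative with the same leading
  coefficient, and \<open>tendsto_div_at_0\<close> lowers the order. The \<open>j\<close>-th
  derivative has a pole of order \<open>j + 2\<close>, so order \<open>N + 1\<close> needs just
  \<open>j < N\<close>, and the base case is the simple pole.\<close>

lemma elliptic_span:
  assumes "elliptic f" "((\<lambda>s. s ^ Suc N * f s) \<longlongrightarrow> c) (at 0)"
  shows "\<exists>b0 b. \<forall>s. s \<notin> \<Lambda> \<longrightarrow> f s = b0 + (\<Sum>j<N. b j * (deriv ^^ j) (wp w1 w2) s)"
  using assms
proof (induction N arbitrary: f c)
  case 0
  then show ?case using elliptic_simple_pole_const[of f c] by auto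
next
  case (Suc N)
  define d :: complex where "d = (-1) ^ N * fact (N + 1)"
  have d: "d \<noteq> 0" unfolding d_def by (rule no_zero_divisors) (simp, rule fact_nonzero)
  define F where "F = (\<lambda>s. f s - c / d * (deriv ^^ N) (wp w1 w2) s)"
  have F: "elliptic F"
    unfolding F_def by (intro elliptic_diff elliptic_mult elliptic_const elliptic_higher_deriv_wp Suc.prems)
  have "((\<lambda>s. s ^ Suc (Suc N) * f s - c / d * (s ^ (N + 2) * (deriv ^^ N) (wp w1 w2) s)) \<longlongrightarrow> c - c / d * d) (at 0)"
    unfolding d_def by (intro tendsto_intros Suc.prems tendsto_higher_deriv_wp)
  then have "((\<lambda>s. s * (s ^ Suc N * F s)) \<longlongrightarrow> 0) (at 0)"
    using d by (simp add: F_def algebra_simps)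
  moreover have "(\<lambda>s. s ^ Suc N * F s) holomorphic_on - \<Lambda>"
    by (intro holomorphic_intros elliptic_holomorphic F)
  ultimately obtain e where "((\<lambda>s. s ^ Suc N * F s) \<longlongrightarrow> e) (at 0)"
    using tendsto_div_at_0 by blast
  from Suc.IH[OF F this] obtain b0 b where
    b: "\<And>s. s \<notin> \<Lambda> \<Longrightarrow> F s = b0 + (\<Sum>j<N. b j * (deriv ^^ j) (wp w1 w2) s)" by blast
  have "f s = b0 + (\<Sum>j<Suc N. (b(N := c / d)) j * (deriv ^^ j) (wp w1 w2) s)" if "s \<notin> \<Lambda>" for s
    using b[OF that] by (simp add: F_def algebra_simps)
  then show ?case by blast
qed

end

section \<open>Elementary symmetric functions and interpolation\<close>

lemma esym_0: "esym 0 x N = 1"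
proof -
  have "{I. I \<subseteq> {..<N} \<and> card I = 0} = {{}}"
    by (auto dest: finite_subset[OF _ finite_lessThan])
  then show ?thesis by (simp add: esym_def)
qed

lemma esym_eq_0: assumes "r > N" shows "esym r x N = 0"
proof -
  have "card I \<noteq> r" if "I \<subseteq> {..<N}" for I
    using card_mono[OF finite_lessThan that] assms by simp
  then have "{I. I \<subseteq> {..<N} \<and> card I = r} = {}" by blast
  then show ?thesis by (simp only: esym_def) simp
qed

text \<open>Subsets are sorted by whether they contain the last index. The recursion serves both
  Vieta's formulas and the final step, where it isolates the unknown value.\<close>

lemma esym_Suc: "esym (Suc r) x (Suc N) = esym (Suc r) x N + x N * esym r x N"
proof -
  let ?A = "\<lambda>r. {I. I \<subseteq> {..<N} \<and> card I = r}"
  have fin: "finite I" if "I \<subseteq> {..<N}" for I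
    using that finite_subset by blast
  have finA: "finite (?A r)" for r by simp
  have notin: "N \<notin> I" if "I \<in> ?A r" for I r using that by auto
  have "{I. I \<subseteq> {..<Suc N} \<and> card I = Suc r} = ?A (Suc r) \<union> insert N ` ?A r" (is "?L = ?R")
  proof
    show "?L \<subseteq> ?R"
    proof
      fix I assume I: "I \<in> ?L"
      show "I \<in> ?R"
      proof (cases "N \<in> I")
        case True
        then have "I = insert N (I - {N})" "I - {N} \<in> ?A r"
          using I by (auto simp: lessThan_Suc)
        then show ?thesis by blast
      next
        case False
        then show ?thesis using I by (auto simp: lessThan_Suc)
      qed
    qed
    show "?R \<subseteq> ?L"
      using notin[of _ r] fin by (auto simp: card_insert_if)
  qed
  then have "esym (Suc r) x (Suc N) = (\<Sum>I\<in>?A (Suc r) \<union> insert N ` ?A r. \<Prod>i\<in>I. x i)"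
    by (simp only: esym_def)
  also have "\<dots> = (\<Sum>I\<in>?A (Suc r). \<Prod>i\<in>I. x i) + (\<Sum>I\<in>insert N ` ?A r. \<Prod>i\<in>I. x i)"
    by (intro sum.union_disjoint finA finite_imageI) auto
  also have "(\<Sum>I\<in>insert N ` ?A r. \<Prod>i\<in>I. x i) = (\<Sum>I\<in>?A r. \<Prod>i\<in>insert N I. x i)"
    by (intro sum.reindex[unfolded o_def]) (auto intro!: inj_onI dest: notin insert_ident[THEN iffD1, rotated 2])
  also have "\<dots> = (\<Sum>I\<in>?A r. x N * (\<Prod>i\<in>I. x i))"
    using notin[of _ r] fin by (intro sum.cong refl prod.insert) auto
  finally show ?thesis by (simp add: esym_def sum_distrib_left)
qed

lemma coeff_prod_linear:
  assumes "r \<le> N"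
  shows "coeff (\<Prod>i<N. [:- x i, 1:]) (N - r) = (-1) ^ r * esym r x N"
  using assms
proof (induction N arbitrary: r)
  case 0
  then show ?case by (simp add: esym_0)
next
  case (Suc N)
  let ?p = "\<Prod>i<N. [:- x i, 1:]"
  have deg: "degree ?p \<le> N"
    using degree_prod_sum_le[of "{..<N}" "\<lambda>i. [:- x i, 1:]"] by simp
  have eq: "coeff (\<Prod>i<Suc N. [:- x i, 1:]) j = (case j of 0 \<Rightarrow> 0 | Suc i \<Rightarrow> coeff ?p i) - x N * coeff ?p j" for j
    by (simp add: mult.commute[of ?p] coeff_pCons split: nat.split)
  show ?case
  proof (cases r)
    case 0
    then show ?thesis using Suc.IH[of 0] deg unfolding eq by (simp add: coeff_eq_0 esym_0)
  next
    case [simp]: (Suc r')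
    then have r': "r' \<le> N" using Suc.prems by simp
    show ?thesis
    proof (cases "r' = N")
      case True
      then show ?thesis using Suc.IH[OF r'] unfolding eq by (simp add: esym_Suc esym_eq_0)
    next
      case False
      then have "Suc N - r = Suc (N - Suc r')" "Suc r' \<le> N" using r' by auto
      then show ?thesis
        using Suc.IH[OF r'] Suc.IH[of "Suc r'"] unfolding eq
        by (simp add: esym_Suc Suc_diff_Suc[symmetric]) (simp add: algebra_simps Suc_diff_le)
    qed
  qed
qed

lemma det_nonzero_kernel:
  fixes A :: "nat \<Rightarrow> nat \<Rightarrow> complex"
  assumes "Determinant.det (Matrix.mat l l (\<lambda>(i, j). A i j)) \<noteq> 0"
    and "\<And>i. i < l \<Longrightarrow> (\<Sum>j<l. x j * A i j) = 0" and "j < l"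
  shows "x j = 0"
proof -
  let ?v = "Matrix.vec l x" and ?A = "Matrix.mat l l (\<lambda>(i, j). A i j)"
  have "?A *\<^sub>v ?v = 0\<^sub>v l"
    using assms(2) by (intro eq_vecI) (auto simp: scalar_prod_def mult.commute atLeast0LessThan)
  then have "?v = 0\<^sub>v l"
    using assms(1) det_0_iff_vec_prod_zero_field[OF mat_carrier, of l "\<lambda>(i, j). A i j"] vec_carrier[of l x]
    by blast
  then show ?thesis using assms(3) by (metis index_vec index_zero_vec(1))
qed

section \<open>Parity, polynomials in the Weierstrass function, and interpolation\<close>

context period_pair
begin

lemma deriv_reflect:
  assumes f: "f holomorphic_on - \<Lambda>" and e: "\<And>s. s \<notin> \<Lambda> \<Longrightarrow> f (- s) = e * f s" and s: "s \<notin> \<Lambda>"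
  shows "deriv f (- s) = - e * deriv f s"
proof -
  have "(f has_field_derivative deriv f (- s)) (at (- s))"
    using holomorphic_derivI[OF f open_compl_lattice(1), of "- s"] s by (simp add: lattice_uminus_iff)
  from DERIV_chain2[of f _ uminus s, OF this DERIV_minus[OF DERIV_ident]]
  have "((\<lambda>s. f (- s)) has_field_derivative - deriv f (- s)) (at s)"
    by simp
  then have "((\<lambda>s. e * f s) has_field_derivative - deriv f (- s)) (at s)"
    by (rule has_field_derivative_transform_within_open[OF _ open_compl_lattice(1)]) (use s e in auto)
  moreover have "((\<lambda>s. e * f s) has_field_derivative e * deriv f s) (at s)"
    using holomorphic_derivI[OF f open_compl_lattice(1), of s] s by (intro DERIV_cmult) simp
  ultimately have "- deriv f (- s) = e * deriv f s" by (rule DERIV_unique)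
  then show ?thesis by (metis add.inverse_inverse mult_minus_left)
qed

lemma higher_deriv_wp_reflect:
  "s \<notin> \<Lambda> \<Longrightarrow> (deriv ^^ j) (wp w1 w2) (- s) = (-1) ^ j * (deriv ^^ j) (wp w1 w2) s"
proof (induction j arbitrary: s)
  case 0
  then show ?case by (simp add: wp_even)
next
  case (Suc j)
  then show ?case
    using deriv_reflect[OF elliptic_holomorphic[OF elliptic_higher_deriv_wp], of j "(-1) ^ j" s] by simp
qed

lemma wpd_reflect:
  assumes "s \<notin> \<Lambda>" "j = -2 \<or> 0 \<le> j"
  shows "wpd w1 w2 j (- s) = (if even j then 1 else - 1) * wpd w1 w2 j s"
  using higher_deriv_wp_reflect[OF assms(1), of "nat j"] assms(2)
  by (auto simp: wpd_def even_nat_iff)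

text \<open>A finite range would be bounded, and a bound would force
  \<open>s\<^sup>2 * wp w1 w2 s\<close> to tend to 0 instead of 1 at the origin.\<close>

lemma infinite_range_wp: "infinite (wp w1 w2 ` (- \<Lambda>))"
proof
  assume "finite (wp w1 w2 ` (- \<Lambda>))"
  then obtain B where B: "\<And>s. s \<notin> \<Lambda> \<Longrightarrow> norm (wp w1 w2 s) \<le> B"
    using finite_imp_bounded bounded_iff by (metis ComplI imageI)
  have lim1: "((\<lambda>s. s\<^sup>2 * wp w1 w2 s) \<longlongrightarrow> 1) (at 0)"
    using tendsto_higher_deriv_wp[of 0] by (simp add: power2_eq_square)
  have "((\<lambda>s. s\<^sup>2 * wp w1 w2 s) \<longlongrightarrow> 0) (at 0)"
  proof (rule Lim_null_comparison)
    show "\<forall>\<^sub>F s in at 0. norm (s\<^sup>2 * wp w1 w2 s) \<le> (norm s)\<^sup>2 * B"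
      using eventually_at_0_not_lattice
      by eventually_elim (auto simp: norm_mult norm_power intro!: mult_left_mono B)
    have "((\<lambda>s::complex. (norm s)\<^sup>2 * B) \<longlongrightarrow> (norm (0::complex))\<^sup>2 * B) (at 0)"
      by (intro tendsto_intros)
    then show "((\<lambda>s::complex. (norm s)\<^sup>2 * B) \<longlongrightarrow> 0) (at 0)" by simp
  qed
  with lim1 show False
    using tendsto_unique[OF at_neq_bot] zero_neq_one by blast
qed

text \<open>Makes the polynomial behind \<open>\<mu>\<close>, a definite description, well defined:
  two candidates agree at infinitely many values.\<close>

lemma poly_wp_unique:
  assumes "\<And>s. s \<notin> \<Lambda> \<Longrightarrow> poly p (wp w1 w2 s) = poly q (wp w1 w2 s)"
  shows "p = q"
proof (rule ccontr)
  assume "p \<noteq> q"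
  then have "finite {x. poly (p - q) x = 0}" by (intro poly_roots_finite) simp
  moreover have "wp w1 w2 ` (- \<Lambda>) \<subseteq> {x. poly (p - q) x = 0}" using assms by auto
  ultimately show False using infinite_range_wp finite_subset by blast
qed

text \<open>Index \<open>j\<close> stands for pole order \<open>j + 2\<close>. The gap at -1
  reflects that order 1 does not occur; the orders 0, 2, ..., \<open>l + 1\<close> remain.\<close>

definition index_set :: "nat \<Rightarrow> int set" where
  "index_set l = insert (-2) (int ` {..<l})"

text \<open>The determinant condition makes evaluation at the \<open>z i\<close> injective on the span of the
  \<open>wpd w1 w2 (k i)\<close>, which has codimension one in the span over the full index set; hence
  the functions in the latter that vanish at all \<open>z i\<close> form a line.\<close>

lemma interpolation_kernel_line:
  assumes k: "\<And>i. i < l \<Longrightarrow> k i \<in> index_set l" "inj_on k {..<l}"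
    and det: "Determinant.det (Matrix.mat l l (\<lambda>(i, j). wpd w1 w2 (k j) (z i))) \<noteq> 0"
    and z: "\<And>i. i < l \<Longrightarrow> z i \<notin> \<Lambda>"
    and f: "\<And>s. s \<notin> \<Lambda> \<Longrightarrow> f s = (\<Sum>j\<in>index_set l. a j * wpd w1 w2 j s)" "\<And>i. i < l \<Longrightarrow> f (z i) = 0"
    and g: "\<And>s. s \<notin> \<Lambda> \<Longrightarrow> g s = (\<Sum>j\<in>index_set l. b j * wpd w1 w2 j s)" "\<And>i. i < l \<Longrightarrow> g (z i) = 0"
    and nz: "s0 \<notin> \<Lambda>" "g s0 \<noteq> 0"
  shows "\<exists>c. \<forall>s. s \<notin> \<Lambda> \<longrightarrow> f s = c * g s"
proof -
  let ?K = "k ` {..<l}"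
  have fin: "finite (index_set l)" by (simp add: index_set_def)
  have "card (index_set l) = Suc l"
    unfolding index_set_def by (subst card_insert_disjoint) (auto simp: card_image)
  moreover have "card ?K = l" using k(2) by (simp add: card_image)
  moreover have sub: "?K \<subseteq> index_set l" using k(1) by auto
  ultimately have "card (index_set l - ?K) = 1" by (simp add: card_Diff_subset)
  then obtain e where "index_set l - ?K = {e}" by (auto simp: card_1_singleton_iff)
  then have e: "index_set l = insert e ?K" "e \<notin> ?K" using sub by auto
  have split: "(\<Sum>j\<in>index_set l. c j * wpd w1 w2 j s) = c e * wpd w1 w2 e s + (\<Sum>i<l. c (k i) * wpd w1 w2 (k i) s)" for c s
    using e k(2) by (simp add: sum.reindex)
  have inj: "x j = 0" if "\<And>i. i < l \<Longrightarrow> (\<Sum>j<l. x j * wpd w1 w2 (k j) (z i)) = 0" "j < l" for x j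
    using det_nonzero_kernel[OF det that] .
  \<comment> \<open>Otherwise \<open>g\<close> would lie in the span of the \<open>k i\<close>
    alone, and vanishing at all \<open>z i\<close> would make it zero, against
    \<open>s0\<close>.\<close>
  have be: "b e \<noteq> 0"
  proof
    assume be: "b e = 0"
    have "b (k j) = 0" if "j < l" for j
      by (rule inj[OF _ that, of "\<lambda>j. b (k j)"]) (use g z split[of b] be in auto)
    then have "g s0 = 0" using g(1)[OF nz(1)] split[of b s0] be by simp
    then show False using nz by simp
  qed
  \<comment> \<open>Chosen so that the leftover index \<open>e\<close> drops out of
    \<open>f s - c * g s\<close>.\<close>
  define c where "c = a e / b e"
  have diff: "f s - c * g s = (\<Sum>i<l. (a (k i) - c * b (k i)) * wpd w1 w2 (k i) s)" if "s \<notin> \<Lambda>" for s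
    unfolding f(1)[OF that] g(1)[OF that] split using be
    by (simp add: c_def algebra_simps sum_subtractf sum_distrib_left)
  have "a (k j) - c * b (k j) = 0" if "j < l" for j
    by (rule inj[OF _ that, of "\<lambda>j. a (k j) - c * b (k j)"]) (simp add: diff[OF z, symmetric] f(2) g(2))
  then have "f s - c * g s = 0" if "s \<notin> \<Lambda>" for s
    using diff[OF that] by simp
  then show ?thesis by (metis eq_iff_diff_eq_0)
qed

end

section \<open>The addition theorem\<close>

lemma sum_over_index_set:
  fixes x :: "nat \<Rightarrow> complex" and D :: "int \<Rightarrow> complex \<Rightarrow> complex"
  assumes "\<And>i. i < m \<Longrightarrow> n i \<in> J" "finite J"
  shows "(\<Sum>i<m. x i * D (n i) s) = (\<Sum>j\<in>J. (\<Sum>i\<in>{i. i < m \<and> n i = j}. x i) * D j s)"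
proof -
  have "(\<Sum>j\<in>J. \<Sum>i\<in>{i \<in> {..<m}. n i = j}. x i * D (n i) s) = (\<Sum>i<m. x i * D (n i) s)"
    by (rule sum.group) (use assms in auto)
  then show ?thesis
    by (simp add: sum_distrib_right)
qed

lemma sum_split_parity:
  fixes n :: "nat \<Rightarrow> int" and x :: "nat \<Rightarrow> complex"
  shows "(\<Sum>i<m. x i) = (\<Sum>i\<in>{i. i < m \<and> odd (n i)}. x i) + (\<Sum>i\<in>{i. i < m \<and> even (n i)}. x i)"
proof -
  have "{..<m} = {i. i < m \<and> odd (n i)} \<union> {i. i < m \<and> even (n i)}" by auto
  then show ?thesis by (simp add: sum.union_disjoint disjoint_iff)
qed

context upper_period_pair
begin

text \<open>With odd part O and even part E, \<open>\<psi>\<close> is O + E at \<open>s\<close> and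
  E - O at \<open>- s\<close>; minus the product of these is a difference of squares. Index -2
  counts as even, in accordance with the constant function.\<close>

lemma phi_eq_reflect_product:
  fixes m l :: nat and n k :: "nat \<Rightarrow> int" and \<gamma> lam :: "nat \<Rightarrow> complex"
  defines "\<psi> \<equiv> (\<lambda>s. (\<Sum>i<m. \<gamma> i * wpd w1 w2 (n i) s) - (\<Sum>i<l. lam i * wpd w1 w2 (k i) s))"
  assumes n: "\<And>i. i < m \<Longrightarrow> n i = -2 \<or> 0 \<le> n i" and k: "\<And>i. i < l \<Longrightarrow> k i = -2 \<or> 0 \<le> k i"
    and s: "s \<notin> \<Lambda>"
  shows "((\<Sum>i\<in>{i. i < m \<and> odd (n i)}. \<gamma> i * wpd w1 w2 (n i) s)
          - (\<Sum>i\<in>{i. i < l \<and> odd (k i)}. lam i * wpd w1 w2 (k i) s))\<^sup>2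
        - ((\<Sum>i\<in>{i. i < m \<and> even (n i)}. \<gamma> i * wpd w1 w2 (n i) s)
          - (\<Sum>i\<in>{i. i < l \<and> even (k i)}. lam i * wpd w1 w2 (k i) s))\<^sup>2 = - (\<psi> s * \<psi> (- s))"
proof -
  define So where "So = (\<lambda>N f x. \<Sum>i\<in>{i. i < (N::nat) \<and> odd (f i :: int)}. x i * wpd w1 w2 (f i) s)"
  define Se where "Se = (\<lambda>N f x. \<Sum>i\<in>{i. i < (N::nat) \<and> even (f i :: int)}. x i * wpd w1 w2 (f i) s)"
  have pos: "(\<Sum>i<N. x i * wpd w1 w2 (f i) s) = So N f x + Se N f x" for N f x
    unfolding So_def Se_def by (rule sum_split_parity)
  have neg: "(\<Sum>i<N. x i * wpd w1 w2 (f i) (- s)) = - So N f x + Se N f x"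
    if "\<And>i. i < N \<Longrightarrow> f i = -2 \<or> 0 \<le> f i" for N f x
    unfolding So_def Se_def sum_negf[symmetric]
    by (subst sum_split_parity[of _ N f], intro arg_cong2[of _ _ _ _ "(+)"] sum.cong refl)
       (use that in \<open>auto simp: wpd_reflect[OF s]\<close>)
  have 1: "\<psi> s = (So m n \<gamma> + Se m n \<gamma>) - (So l k lam + Se l k lam)"
    unfolding \<psi>_def by (simp only: pos)
  have 2: "\<psi> (- s) = (- So m n \<gamma> + Se m n \<gamma>) - (- So l k lam + Se l k lam)"
    unfolding \<psi>_def using neg[of m n \<gamma>, OF n] neg[of l k lam, OF k] by simp
  show ?thesis
    unfolding 1 2 So_def Se_def power2_eq_square by (simp add: algebra_simps)
qed

lemma phi_eq_prod_wp:
  fixes m l :: nat and n k :: "nat \<Rightarrow> int" and \<gamma> lam z :: "nat \<Rightarrow> complex"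
  defines "\<psi> \<equiv> (\<lambda>s. (\<Sum>i<m. \<gamma> i * wpd w1 w2 (n i) s) - (\<Sum>i<l. lam i * wpd w1 w2 (k i) s))"
  defines "a \<equiv> (\<lambda>i. if i < l then z i else - (\<Sum>i<l. z i))"
  assumes n: "\<And>i. i < m \<Longrightarrow> n i \<in> index_set l" and k: "\<And>i. i < l \<Longrightarrow> k i \<in> index_set l" "inj_on k {..<l}"
    and det: "Determinant.det (Matrix.mat l l (\<lambda>(i, j). wpd w1 w2 (k j) (z i))) \<noteq> 0"
    and z: "\<And>i. i < l \<Longrightarrow> z i \<notin> \<Lambda>" "(\<Sum>i<l. z i) \<notin> \<Lambda>"
    and lam: "\<And>i. i < l \<Longrightarrow> \<psi> (z i) = 0"
    and pole: "is_pole \<psi> 0"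
  shows "\<exists>C. C \<noteq> 0 \<and> (\<forall>s. s \<notin> \<Lambda> \<longrightarrow> - (\<psi> s * \<psi> (- s)) = C * (\<Prod>i<Suc l. wp w1 w2 s - wp w1 w2 (a i)))"
proof -
  have aL: "a i \<notin> \<Lambda>" for i
    using z by (simp add: a_def lattice_uminus_iff)
  define h where "h = (\<lambda>s. \<Prod>i<Suc l. theta_quot (a i) s)"
  have sum0: "(\<Sum>i<Suc l. a i) = 0" by (simp add: a_def)
  have h: "elliptic h"
    unfolding h_def by (rule elliptic_prod_theta_quot[OF sum0])
  have hlim: "((\<lambda>s. s ^ Suc l * h s) \<longlongrightarrow> (\<Prod>i<Suc l. theta (- a i) / theta_slope)) (at 0)"
    unfolding h_def by (rule prod_theta_quot_tendsto)
  have "(\<Prod>i<Suc l. theta (- a i) / theta_slope) \<noteq> 0"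
    using theta_nz[of "- a _"] aL theta_slope_nz by (simp add: lattice_uminus_iff del: prod.lessThan_Suc)
  from tendsto_imp_eventually_ne[OF hlim this] eventually_at_0_not_lattice
  have "\<forall>\<^sub>F s in at 0. s \<notin> \<Lambda> \<and> h s \<noteq> 0"
    by eventually_elim auto
  then obtain s0 where s0: "s0 \<notin> \<Lambda>" "h s0 \<noteq> 0"
    using eventually_happens'[OF at_neq_bot] by blast
  \<comment> \<open>The pole shows that \<open>\<psi>\<close> does not vanish identically, so the
    factor \<open>c\<close> below is nonzero.\<close>
  from non_zero_neighbour_pole[OF pole] eventually_at_0_not_lattice
  have "\<forall>\<^sub>F s in at 0. s \<notin> \<Lambda> \<and> \<psi> s \<noteq> 0"
    by eventually_elim auto
  then obtain s1 where s1: "s1 \<notin> \<Lambda>" "\<psi> s1 \<noteq> 0"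
    using eventually_happens'[OF at_neq_bot] by blast
  have fin: "finite (index_set l)" by (simp add: index_set_def)
  obtain b0 b where b: "\<And>s. s \<notin> \<Lambda> \<Longrightarrow> h s = b0 + (\<Sum>j<l. b j * (deriv ^^ j) (wp w1 w2) s)"
    using elliptic_span[OF h hlim] by blast
  have h_span: "h s = (\<Sum>j\<in>index_set l. (if j = -2 then b0 else b (nat j)) * wpd w1 w2 j s)" if "s \<notin> \<Lambda>" for s
  proof -
    have "-2 \<notin> int ` {..<l}" by auto
    then show ?thesis
      unfolding b[OF that] index_set_def by (simp add: sum.reindex wpd_def)
  qed
  \<comment> \<open>An index may occur both among the \<open>n i\<close> and among the
    \<open>k i\<close>; \<open>p\<close> collects the two contributions.\<close>
  define p where "p = (\<lambda>j. (\<Sum>i\<in>{i. i < m \<and> n i = j}. \<gamma> i) - (\<Sum>i\<in>{i. i < l \<and> k i = j}. lam i))"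
  have psi_span: "\<psi> s = (\<Sum>j\<in>index_set l. p j * wpd w1 w2 j s)" for s
    unfolding \<psi>_def p_def using sum_over_index_set[of m n, OF n fin] sum_over_index_set[of l k, OF k(1) fin]
    by (simp add: left_diff_distrib sum_subtractf)
  have h0: "h (z i) = 0" if "i < l" for i
    unfolding h_def using that by (intro prod_zero bexI[of _ i]) (auto simp: a_def theta_quot_self)
  obtain c where c: "\<And>s. s \<notin> \<Lambda> \<Longrightarrow> \<psi> s = c * h s"
    using interpolation_kernel_line[OF k det z(1) psi_span lam h_span h0 s0] by blast
  have c0: "c \<noteq> 0" using c s1 by force
  obtain d where d: "\<And>i. d i \<noteq> 0"
    "\<And>i s. s \<notin> \<Lambda> \<Longrightarrow> theta_quot (a i) s * theta_quot (- a i) s = d i * (wp w1 w2 s - wp w1 w2 (a i))"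
    using theta_quot_pair[OF aL] by metis
  \<comment> \<open>\<open>c * c\<close> comes from the two values of \<open>\<psi>\<close>, the
    \<open>d i\<close> from the pairing, and the divisors \<open>wexp (a i)\<close> from reflecting
    the theta quotients in \<open>h (- s)\<close>.\<close>
  define C where "C = - (c * c * (\<Prod>i<Suc l. d i / wexp (a i)))"
  have "- (\<psi> s * \<psi> (- s)) = C * (\<Prod>i<Suc l. wp w1 w2 s - wp w1 w2 (a i))" if s: "s \<notin> \<Lambda>" for s
  proof -
    have "h s * h (- s) = (\<Prod>i<Suc l. theta_quot (a i) s * theta_quot (- a i) s / wexp (a i))"
      by (simp only: h_def theta_quot_uminus prod.distrib[symmetric] times_divide_eq_right)
    also have "\<dots> = (\<Prod>i<Suc l. d i / wexp (a i) * (wp w1 w2 s - wp w1 w2 (a i)))"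
      by (simp only: d(2)[OF s] times_divide_eq_left)
    also have "\<dots> = (\<Prod>i<Suc l. d i / wexp (a i)) * (\<Prod>i<Suc l. wp w1 w2 s - wp w1 w2 (a i))"
      by (rule prod.distrib)
    finally have "h s * h (- s) = (\<Prod>i<Suc l. d i / wexp (a i)) * (\<Prod>i<Suc l. wp w1 w2 s - wp w1 w2 (a i))" .
    moreover have "\<psi> s * \<psi> (- s) = c * c * (h s * h (- s))"
      using c[OF s] c[of "- s"] s by (simp add: lattice_uminus_iff)
    ultimately show ?thesis by (simp only: C_def) (simp only: mult.assoc mult_minus_left)
  qed
  moreover have "C \<noteq> 0" using c0 d(1) by (simp add: C_def)
  ultimately show ?thesis by blast
qed

text \<open>Uniqueness identifies the definite description with an explicit product, and dividing by
  its top coefficient removes the unknown \<open>C\<close>.\<close>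

lemma wp_Vieta:
  assumes C: "C \<noteq> 0" and F: "\<And>s. s \<notin> \<Lambda> \<Longrightarrow> F s = C * (\<Prod>i<N. wp w1 w2 s - x i)"
    and r: "r \<le> N"
  shows "(-1) ^ r * coeff (THE Q. degree Q \<le> N \<and> (\<forall>s. s \<notin> \<Lambda> \<longrightarrow> F s = poly Q (wp w1 w2 s))) (N - r)
      / coeff (THE Q. degree Q \<le> N \<and> (\<forall>s. s \<notin> \<Lambda> \<longrightarrow> F s = poly Q (wp w1 w2 s))) N = esym r x N"
proof -
  define Q where "Q = Polynomial.smult C (\<Prod>i<N. [:- x i, 1:])"
  have the: "(THE Q. degree Q \<le> N \<and> (\<forall>s. s \<notin> \<Lambda> \<longrightarrow> F s = poly Q (wp w1 w2 s))) = Q"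
  proof (rule the_equality)
    have "degree (\<Prod>i<N. [:- x i, 1:]) \<le> N"
      using degree_prod_sum_le[of "{..<N}" "\<lambda>i. [:- x i, 1:]"] by simp
    moreover have "F s = poly Q (wp w1 w2 s)" if "s \<notin> \<Lambda>" for s
      using F[OF that] by (simp add: Q_def poly_prod)
    ultimately show "degree Q \<le> N \<and> (\<forall>s. s \<notin> \<Lambda> \<longrightarrow> F s = poly Q (wp w1 w2 s))"
      using C by (simp add: Q_def)
    then show "Q' = Q" if "degree Q' \<le> N \<and> (\<forall>s. s \<notin> \<Lambda> \<longrightarrow> F s = poly Q' (wp w1 w2 s))" for Q'
      using that by (intro poly_wp_unique) metis
  qed
  have "coeff Q (N - r) = C * ((-1) ^ r * esym r x N)" "coeff Q N = C"
    using coeff_prod_linear[OF r, of x] coeff_prod_linear[of 0 N x] by (simp_all add: Q_def esym_0)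
  moreover have "(-1) ^ r * (C * ((-1) ^ r * esym r x N)) = C * esym r x N"
    by (cases "even r") simp_all
  ultimately show ?thesis
    unfolding the using C by simp
qed

end

theorem mainTheorem5:
  fixes w1 w2 :: complex and m l :: nat
    and n :: "nat \<Rightarrow> int" and k :: "nat \<Rightarrow> int"
    and \<gamma> lam z :: "nat \<Rightarrow> complex" and r :: nat
  defines "\<Lambda> \<equiv> lattice w1 w2"
    and "P \<equiv> wp w1 w2"
    and "D \<equiv> wpd w1 w2"
  defines "\<psi> \<equiv> (\<lambda>s. (\<Sum>i<m. \<gamma> i * D (n i) s) - (\<Sum>i<l. lam i * D (k i) s))"
    and "\<phi> \<equiv> (\<lambda>s. ((\<Sum>i\<in>{i. i < m \<and> odd (n i)}. \<gamma> i * D (n i) s)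
                    - (\<Sum>i\<in>{i. i < l \<and> odd (k i)}. lam i * D (k i) s))\<^sup>2
                - ((\<Sum>i\<in>{i. i < m \<and> even (n i)}. \<gamma> i * D (n i) s)
                    - (\<Sum>i\<in>{i. i < l \<and> even (k i)}. lam i * D (k i) s))\<^sup>2)"
  defines "\<mu> \<equiv> coeff (THE Q. degree Q \<le> l + 1 \<and> (\<forall>s. s \<notin> \<Lambda> \<longrightarrow> \<phi> s = poly Q (P s)))"
  assumes period: "Im (w2 / w1) > 0"
    and ml: "m \<ge> 1" "l \<ge> 1"
    and n_range: "\<forall>i<m. n i = -2 \<or> n i \<ge> 0" and n_inj: "inj_on n {..<m}"
    and k_range: "\<forall>i<l. k i = -2 \<or> k i \<ge> 0" and k_inj: "inj_on k {..<l}"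
    and l_def: "int l = max (Max (n ` {..<m})) (Max (k ` {..<l})) + 1"
    and z_notin: "\<forall>i<l. z i \<notin> \<Lambda>"
    and det_nz: "det (mat l l (\<lambda>(i, j). D (k j) (z i))) \<noteq> 0"
    and lam: "\<forall>j<l. (\<Sum>i<m. \<gamma> i * D (n i) (z j)) = (\<Sum>i<l. lam i * D (k i) (z j))"
    and sum_notin: "(\<Sum>i<l. z i) \<notin> \<Lambda>"
    and pole: "is_pole \<psi> 0" "zorder \<psi> 0 = - int (l + 1)"
    and phi_nz: "\<exists>s. s \<notin> \<Lambda> \<and> \<phi> s \<noteq> 0"
    and sum_ne: "\<forall>i<l. (\<Sum>j<l. z j) - z i \<notin> \<Lambda> \<and> (\<Sum>j<l. z j) + z i \<notin> \<Lambda>"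
    and pair_ne: "\<forall>i<l. \<forall>j<l. i \<noteq> j \<longrightarrow> z i + z j \<notin> \<Lambda>"
    and r_range: "1 \<le> r" "r \<le> l + 1"
    and S_nz: "esym (r - 1) (\<lambda>i. P (z i)) l \<noteq> 0"
  shows "P (\<Sum>i<l. z i) =
    1 / esym (r - 1) (\<lambda>i. P (z i)) l *
      ((-1) ^ r * \<mu> (l + 1 - r) / \<mu> (l + 1) - esym r (\<lambda>i. P (z i)) l)"
proof -
  interpret L: upper_period_pair w1 w2 by unfold_locales (rule period)
  have Max_n: "n i \<le> int l - 1" if "i < m" for i
  proof -
    have "n i \<le> Max (n ` {..<m})" using that by simp
    then show ?thesis using l_def by linarith
  qed
  have Max_k: "k i \<le> int l - 1" if "i < l" for i
  proof -
    have "k i \<le> Max (k ` {..<l})" using that by simp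
    then show ?thesis using l_def by linarith
  qed
  have index: "j \<in> L.index_set l" if "j = -2 \<or> 0 \<le> j" "j \<le> int l - 1" for j
    using that unfolding L.index_set_def by (auto simp: image_iff intro!: bexI[of _ "nat j"])
  define a where "a = (\<lambda>i. if i < l then z i else - (\<Sum>i<l. z i))"
  have "\<exists>C. C \<noteq> 0 \<and> (\<forall>s. s \<notin> \<Lambda> \<longrightarrow> - (\<psi> s * \<psi> (- s)) = C * (\<Prod>i<Suc l. P s - P (a i)))"
    unfolding \<psi>_def a_def \<Lambda>_def P_def D_def
  proof (rule L.phi_eq_prod_wp)
    show "n i \<in> L.index_set l" if "i < m" for i
      using index n_range Max_n that by blast
    show "k i \<in> L.index_set l" if "i < l" for i
      using index k_range Max_k that by blast
  qed (use k_inj det_nz z_notin sum_notin lam pole(1) in \<open>simp_all add: \<psi>_def \<Lambda>_def D_def\<close>)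
  then obtain C where C: "C \<noteq> 0"
    "\<And>s. s \<notin> \<Lambda> \<Longrightarrow> - (\<psi> s * \<psi> (- s)) = C * (\<Prod>i<Suc l. P s - P (a i))" by blast
  have \<phi>: "\<phi> s = C * (\<Prod>i<Suc l. P s - P (a i))" if "s \<notin> \<Lambda>" for s
    using C(2)[OF that] L.phi_eq_reflect_product[of m n l k s \<gamma> lam] n_range k_range that
    unfolding \<phi>_def \<psi>_def D_def \<Lambda>_def by simp
  let ?x = "\<lambda>i. P (a i)" and ?y = "\<lambda>i. P (z i)"
  have "(-1) ^ r * \<mu> (l + 1 - r) / \<mu> (l + 1) = esym r ?x (Suc l)"
    using L.wp_Vieta[where C = C and F = \<phi> and N = "Suc l" and x = ?x and r = r] C(1) \<phi> r_range(2) unfolding \<mu>_def \<Lambda>_def P_def by simp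
  \<comment> \<open>Separating the last variable leaves an equation linear in
    \<open>P (a l)\<close>, whose coefficient is the divisor in the claim.\<close>
  also have "\<dots> = esym r ?x l + ?x l * esym (r - 1) ?x l"
    using esym_Suc[of "r - 1" ?x l] r_range(1) by simp
  also have "\<dots> = esym r ?y l + P (\<Sum>i<l. z i) * esym (r - 1) ?y l"
  proof -
    have "esym j ?x l = esym j ?y l" for j
      unfolding esym_def by (intro sum.cong prod.cong) (auto simp: a_def)
    \<comment> \<open>The extra zero is minus the sum of the \<open>z i\<close>; evenness of
      \<open>wp\<close> gives the value at the sum itself.\<close>
    moreover have "?x l = P (\<Sum>i<l. z i)"
      by (simp add: a_def P_def L.wp_even)
    ultimately show ?thesis by (simp only:)
  qed
  finally show ?thesis
    using S_nz by simp
qed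

end
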